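(* Let $n$ be an odd integer. Then the number of pairwise non-isomorphic (as rings) generalized quaternion rings over $\mathbb{Z}/n\mathbb{Z}$, i.e. the number of isomorphism classes of rings of the form $\left(\frac{a,b}{\mathbb{Z}/n\mathbb{Z}}\right)$ with $a,b\in\mathbb{Z}/n\mathbb{Z}$ arbitrary, is $$2^{\omega(n)}\prod_{p\mid n}\left(\nu_p(n)^2+1\right),$$ where the product runs over the primes $p$ dividing $n$.
   Context: For a commutative ring $R$ with identity and $a,b\in R$ (not necessarily units, possibly zero), the generalized quaternion ring $\left(\frac{a,b}{R}\right)$ is the free $R$-module with basis $\{1,i,j,k\}$ equipped with the associative unital $R$-bilinear multiplication determined by $i^2=a$, $j^2=b$, $ij=-ji=k$. Here $\omega(n)$ denotes the number of distinct primes dividing $n$, and $\nu_p(n)$ denotes the $p$-adic order of $n$ (the exponent of $p$ in the prime factorization of $n$). *)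

theory Defs
  imports
    "HOL-Algebra.IntRing"
    "HOL-Algebra.QuotRing"
    "HOL-Computational_Algebra.Primes"
begin

text \<open>
  The tuple \<open>(x0, x1, x2, x3)\<close> stands for \<open>x0 + x1 i + x2 j + x3 k\<close>. The multiplication is the
  bilinear extension of the table forced by \<open>i\<^sup>2 = a\<close>, \<open>j\<^sup>2 = b\<close>, \<open>ij = -ji = k\<close> and associativity:
  \<open>k\<^sup>2 = -ab\<close>, \<open>ik = -ki = a j\<close>, \<open>kj = -jk = b i\<close>.
\<close>

definition quaternion_ring ::
  "('a, 'm) ring_scheme \<Rightarrow> 'a \<Rightarrow> 'a \<Rightarrow> ('a \<times> 'a \<times> 'a \<times> 'a) ring" where
  "quaternion_ring R a b =
    \<lparr>carrier = carrier R \<times> carrier R \<times> carrier R \<times> carrier R,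
     monoid.mult = (\<lambda>(x0, x1, x2, x3) (y0, y1, y2, y3).
       (x0 \<otimes>\<^bsub>R\<^esub> y0 \<oplus>\<^bsub>R\<^esub> a \<otimes>\<^bsub>R\<^esub> (x1 \<otimes>\<^bsub>R\<^esub> y1) \<oplus>\<^bsub>R\<^esub> b \<otimes>\<^bsub>R\<^esub> (x2 \<otimes>\<^bsub>R\<^esub> y2) \<ominus>\<^bsub>R\<^esub> a \<otimes>\<^bsub>R\<^esub> b \<otimes>\<^bsub>R\<^esub> (x3 \<otimes>\<^bsub>R\<^esub> y3),
        x0 \<otimes>\<^bsub>R\<^esub> y1 \<oplus>\<^bsub>R\<^esub> x1 \<otimes>\<^bsub>R\<^esub> y0 \<oplus>\<^bsub>R\<^esub> b \<otimes>\<^bsub>R\<^esub> (x3 \<otimes>\<^bsub>R\<^esub> y2) \<ominus>\<^bsub>R\<^esub> b \<otimes>\<^bsub>R\<^esub> (x2 \<otimes>\<^bsub>R\<^esub> y3),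
        x0 \<otimes>\<^bsub>R\<^esub> y2 \<oplus>\<^bsub>R\<^esub> x2 \<otimes>\<^bsub>R\<^esub> y0 \<oplus>\<^bsub>R\<^esub> a \<otimes>\<^bsub>R\<^esub> (x1 \<otimes>\<^bsub>R\<^esub> y3) \<ominus>\<^bsub>R\<^esub> a \<otimes>\<^bsub>R\<^esub> (x3 \<otimes>\<^bsub>R\<^esub> y1),
        x0 \<otimes>\<^bsub>R\<^esub> y3 \<oplus>\<^bsub>R\<^esub> x3 \<otimes>\<^bsub>R\<^esub> y0 \<oplus>\<^bsub>R\<^esub> x1 \<otimes>\<^bsub>R\<^esub> y2 \<ominus>\<^bsub>R\<^esub> x2 \<otimes>\<^bsub>R\<^esub> y1)),
     one = (\<one>\<^bsub>R\<^esub>, \<zero>\<^bsub>R\<^esub>, \<zero>\<^bsub>R\<^esub>, \<zero>\<^bsub>R\<^esub>),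
     zero = (\<zero>\<^bsub>R\<^esub>, \<zero>\<^bsub>R\<^esub>, \<zero>\<^bsub>R\<^esub>, \<zero>\<^bsub>R\<^esub>),
     add = (\<lambda>(x0, x1, x2, x3) (y0, y1, y2, y3).
       (x0 \<oplus>\<^bsub>R\<^esub> y0, x1 \<oplus>\<^bsub>R\<^esub> y1, x2 \<oplus>\<^bsub>R\<^esub> y2, x3 \<oplus>\<^bsub>R\<^esub> y3))\<rparr>"

definition quaternion_rings :: "('a, 'm) ring_scheme \<Rightarrow> ('a \<times> 'a \<times> 'a \<times> 'a) ring set" where
  "quaternion_rings R = {quaternion_ring R a b | a b. a \<in> carrier R \<and> b \<in> carrier R}"

definition ring_iso_rel :: "'a ring set \<Rightarrow> ('a ring \<times> 'a ring) set" where
  "ring_iso_rel \<A> = {(A, B). A \<in> \<A> \<and> B \<in> \<A> \<and> A \<simeq> B}"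

lemma quaternion_ring_relations:
  assumes "cring R" "a \<in> carrier R" "b \<in> carrier R"
  defines "Q \<equiv> quaternion_ring R a b"
    and "emb \<equiv> \<lambda>r. (r, \<zero>\<^bsub>R\<^esub>, \<zero>\<^bsub>R\<^esub>, \<zero>\<^bsub>R\<^esub>)"
    and "i \<equiv> (\<zero>\<^bsub>R\<^esub>, \<one>\<^bsub>R\<^esub>, \<zero>\<^bsub>R\<^esub>, \<zero>\<^bsub>R\<^esub>)"
    and "j \<equiv> (\<zero>\<^bsub>R\<^esub>, \<zero>\<^bsub>R\<^esub>, \<one>\<^bsub>R\<^esub>, \<zero>\<^bsub>R\<^esub>)"
    and "k \<equiv> (\<zero>\<^bsub>R\<^esub>, \<zero>\<^bsub>R\<^esub>, \<zero>\<^bsub>R\<^esub>, \<one>\<^bsub>R\<^esub>)"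
  shows "i \<otimes>\<^bsub>Q\<^esub> i = emb a" "j \<otimes>\<^bsub>Q\<^esub> j = emb b"
    and "i \<otimes>\<^bsub>Q\<^esub> j = k" "(j \<otimes>\<^bsub>Q\<^esub> i) \<oplus>\<^bsub>Q\<^esub> k = \<zero>\<^bsub>Q\<^esub>"
    and "\<lbrakk>x0 \<in> carrier R; x1 \<in> carrier R; x2 \<in> carrier R; x3 \<in> carrier R\<rbrakk> \<Longrightarrow>
      (x0, x1, x2, x3) =
        emb x0 \<oplus>\<^bsub>Q\<^esub> emb x1 \<otimes>\<^bsub>Q\<^esub> i \<oplus>\<^bsub>Q\<^esub> emb x2 \<otimes>\<^bsub>Q\<^esub> j \<oplus>\<^bsub>Q\<^esub> emb x3 \<otimes>\<^bsub>Q\<^esub> k"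
proof -
  interpret R: cring R by fact
  show "i \<otimes>\<^bsub>Q\<^esub> i = emb a" "j \<otimes>\<^bsub>Q\<^esub> j = emb b"
    and "i \<otimes>\<^bsub>Q\<^esub> j = k" "(j \<otimes>\<^bsub>Q\<^esub> i) \<oplus>\<^bsub>Q\<^esub> k = \<zero>\<^bsub>Q\<^esub>"
    using assms(2,3)
    by (simp_all add: Q_def emb_def i_def j_def k_def quaternion_ring_def R.minus_eq R.l_neg)
  show "(x0, x1, x2, x3) =
        emb x0 \<oplus>\<^bsub>Q\<^esub> emb x1 \<otimes>\<^bsub>Q\<^esub> i \<oplus>\<^bsub>Q\<^esub> emb x2 \<otimes>\<^bsub>Q\<^esub> j \<oplus>\<^bsub>Q\<^esub> emb x3 \<otimes>\<^bsub>Q\<^esub> k"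
    if "x0 \<in> carrier R" "x1 \<in> carrier R" "x2 \<in> carrier R" "x3 \<in> carrier R"
    using assms(2,3) that
    by (simp add: Q_def emb_def i_def j_def k_def quaternion_ring_def R.minus_eq)
qed

lemma ring_quaternion_ring:
  assumes "cring R" and ab: "a \<in> carrier R" "b \<in> carrier R"
  shows "ring (quaternion_ring R a b)"
proof -
  interpret R: cring R by fact
  show ?thesis
  proof (rule ringI)
    show "abelian_group (quaternion_ring R a b)"
    proof (rule abelian_groupI)
      fix x assume "x \<in> carrier (quaternion_ring R a b)"
      then obtain x0 x1 x2 x3 where "x = (x0, x1, x2, x3)"
        "x0 \<in> carrier R" "x1 \<in> carrier R" "x2 \<in> carrier R" "x3 \<in> carrier R"
        by (auto simp: quaternion_ring_def)
      then show "\<exists>y\<in>carrier (quaternion_ring R a b).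
          y \<oplus>\<^bsub>quaternion_ring R a b\<^esub> x = \<zero>\<^bsub>quaternion_ring R a b\<^esub>"
        by (intro bexI[of _ "(\<ominus>\<^bsub>R\<^esub> x0, \<ominus>\<^bsub>R\<^esub> x1, \<ominus>\<^bsub>R\<^esub> x2, \<ominus>\<^bsub>R\<^esub> x3)"])
          (auto simp: quaternion_ring_def R.l_neg)
    qed (auto simp: quaternion_ring_def R.a_ac)
    show "monoid (quaternion_ring R a b)"
    proof (rule monoidI, goal_cases)
      case (3 x y z)
      then show ?case using ab
        by (clarsimp simp: quaternion_ring_def) (intro conjI; simp add: R.minus_eq R.l_distr R.r_distr R.l_minus R.r_minus R.minus_add R.m_ac R.a_ac)
    qed (use ab in \<open>auto simp: quaternion_ring_def R.minus_eq\<close>)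
  next
    fix x y z
    assume xyz: "x \<in> carrier (quaternion_ring R a b)" "y \<in> carrier (quaternion_ring R a b)"
      "z \<in> carrier (quaternion_ring R a b)"
    show "(x \<oplus>\<^bsub>quaternion_ring R a b\<^esub> y) \<otimes>\<^bsub>quaternion_ring R a b\<^esub> z =
        x \<otimes>\<^bsub>quaternion_ring R a b\<^esub> z \<oplus>\<^bsub>quaternion_ring R a b\<^esub> y \<otimes>\<^bsub>quaternion_ring R a b\<^esub> z"
      using xyz ab by (clarsimp simp: quaternion_ring_def) (intro conjI; simp add: R.minus_eq R.l_distr R.r_distr R.l_minus R.r_minus R.minus_add R.m_ac R.a_ac)
    show "z \<otimes>\<^bsub>quaternion_ring R a b\<^esub> (x \<oplus>\<^bsub>quaternion_ring R a b\<^esub> y) =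
        z \<otimes>\<^bsub>quaternion_ring R a b\<^esub> x \<oplus>\<^bsub>quaternion_ring R a b\<^esub> z \<otimes>\<^bsub>quaternion_ring R a b\<^esub> y"
      using xyz ab by (clarsimp simp: quaternion_ring_def) (intro conjI; simp add: R.minus_eq R.l_distr R.r_distr R.l_minus R.r_minus R.minus_add R.m_ac R.a_ac)
  qed
qed

end

theory Submission
  imports Defs "HOL-Number_Theory.Number_Theory"
begin

text \<open>
  For odd \<open>n\<close>, an isomorphism from \<open>(a, b)\<close> to \<open>(c, d)\<close> over \<open>\<int>/n\<close> is the same as a pair of
  anticommuting pure quaternions \<open>I, J\<close> in \<open>(c, d)\<close> with \<open>I\<^sup>2 = a\<close>, \<open>J\<^sup>2 = b\<close> such that \<open>1, I, J, IJ\<close> is a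
  basis. This is a system of polynomial congruences, so by the Chinese remainder theorem the classes
  modulo \<open>n\<close> are the tuples of classes modulo the prime powers \<open>p\<^sup>s\<close> exactly dividing \<open>n\<close>.

  Modulo \<open>p\<^sup>s\<close> write the parameters as \<open>(p\<^sup>i u, p\<^sup>j v)\<close> with \<open>i \<le> j \<le> s\<close> and units \<open>u, v\<close>, which matter only
  up to squares. Binary forms with unit coefficients represent unit squares, so \<open>v\<close> can be normalised to \<open>1\<close>
  if \<open>i = 0\<close>, also \<open>u\<close> if \<open>i = j = 0\<close>, and \<open>u\<close> if \<open>i = j\<close>; the unit part of a parameter that vanishes is
  irrelevant. The exponents and the remaining square classes are invariants, as one sees by reducing
  the congruences modulo \<open>p\<^bsup>i+1\<^esup>\<close> and \<open>p\<^bsup>j+1\<^esup>\<close>. Hence the number of classes modulo \<open>p\<^sup>s\<close> is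
  \<open>1 + 2 s + 2 (s - 1) + 2 (s - 1) (s - 2) + 2 (s - 1) + 1 = 2 (s\<^sup>2 + 1)\<close>.
\<close>

section \<open>Quaternion rings over the integers modulo n\<close>

lemma carrier_ZFact: "carrier (ZFact n) = range (ZMod n)"
  by (auto simp: ZFact_defs ZMod_def A_RCOSETS_def' UNIV)

lemma ZMod_ring_hom: "ZMod n \<in> ring_hom \<Z> (ZFact n)"
proof -
  have "ZMod n = (+>\<^bsub>\<Z>\<^esub>) (Idl\<^bsub>\<Z>\<^esub> {n})"
    by (rule ext) (simp add: ZMod_def)
  then show ?thesis
    using ideal.rcos_ring_hom[OF int.genideal_ideal, of "{n}"] by (simp add: ZFact_def)
qed

lemma ZFact_add_ZMod: "ZMod n x \<oplus>\<^bsub>ZFact n\<^esub> ZMod n y = ZMod n (x + y)"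
  using ring_hom_add[OF ZMod_ring_hom, of x y n] by simp

lemma ZFact_mult_ZMod: "ZMod n x \<otimes>\<^bsub>ZFact n\<^esub> ZMod n y = ZMod n (x * y)"
  using ring_hom_mult[OF ZMod_ring_hom, of x y n] by simp

lemma ZFact_zero_ZMod: "\<zero>\<^bsub>ZFact n\<^esub> = ZMod n 0"
  using ring_hom_zero[OF ZMod_ring_hom int.ring_axioms cring.axioms(1)[OF ZFact_is_cring], of n]
  by simp

lemma ZFact_one_ZMod: "\<one>\<^bsub>ZFact n\<^esub> = ZMod n 1"
  using ring_hom_one[OF ZMod_ring_hom, of n] by simp

lemma ZFact_uminus_ZMod: "\<ominus>\<^bsub>ZFact n\<^esub> ZMod n x = ZMod n (- x)"
proof -
  interpret cring "ZFact n" by (rule ZFact_is_cring)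
  show ?thesis
    by (rule minus_equality) (simp_all add: ZFact_add_ZMod ZFact_zero_ZMod carrier_ZFact)
qed

lemma ZFact_minus_ZMod: "ZMod n x \<ominus>\<^bsub>ZFact n\<^esub> ZMod n y = ZMod n (x - y)"
  by (simp add: a_minus_def ZFact_uminus_ZMod ZFact_add_ZMod)

lemmas ZFact_ZMod_simps = ZFact_add_ZMod ZFact_mult_ZMod ZFact_zero_ZMod ZFact_one_ZMod
  ZFact_uminus_ZMod ZFact_minus_ZMod

lemma ZMod_eq_iff_cong: "ZMod n x = ZMod n y \<longleftrightarrow> [x = y] (mod n)"
  by (simp add: ZMod_eq_mod cong_def)

text \<open>Finiteness later turns an injective homomorphism into a bijective one.\<close>

lemma finite_carrier_ZFact:
  assumes "n \<noteq> 0"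
  shows "finite (carrier (ZFact n))"
proof -
  have "ZMod n x \<in> ZMod n ` {-\<bar>n\<bar>..\<bar>n\<bar>}" for x
    using assms abs_mod_less[of n x] by (subst ZMod_mod) (intro imageI, auto)
  then have "carrier (ZFact n) \<subseteq> ZMod n ` {-\<bar>n\<bar>..\<bar>n\<bar>}"
    by (auto simp: carrier_ZFact)
  then show ?thesis by (rule finite_subset) simp
qed

section \<open>Quaternions with integer coordinates and their isomorphisms modulo n\<close>

type_synonym int4 = "int \<times> int \<times> int \<times> int"

text \<open>The multiplication of \<open>quaternion_ring\<close> on integer representatives, so that
  identities in the ring become polynomial identities over the integers.\<close>

definition quat_mult :: "int \<Rightarrow> int \<Rightarrow> int4 \<Rightarrow> int4 \<Rightarrow> int4" where
  "quat_mult a b = (\<lambda>(x0, x1, x2, x3) (y0, y1, y2, y3).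
     (x0 * y0 + a * (x1 * y1) + b * (x2 * y2) - a * b * (x3 * y3),
      x0 * y1 + x1 * y0 + b * (x3 * y2) - b * (x2 * y3),
      x0 * y2 + x2 * y0 + a * (x1 * y3) - a * (x3 * y1),
      x0 * y3 + x3 * y0 + x1 * y2 - x2 * y1))"

definition quat_add :: "int4 \<Rightarrow> int4 \<Rightarrow> int4" where
  "quat_add = (\<lambda>(x0, x1, x2, x3) (y0, y1, y2, y3). (x0 + y0, x1 + y1, x2 + y2, x3 + y3))"

definition quat_scale :: "int \<Rightarrow> int4 \<Rightarrow> int4" where
  "quat_scale k = (\<lambda>(x0, x1, x2, x3). (k * x0, k * x1, k * x2, k * x3))"

definition quat_ZMod :: "int \<Rightarrow> int4 \<Rightarrow> int set \<times> int set \<times> int set \<times> int set" where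
  "quat_ZMod n = (\<lambda>(x0, x1, x2, x3). (ZMod n x0, ZMod n x1, ZMod n x2, ZMod n x3))"

abbreviation quat_ring_mod :: "int \<Rightarrow> int \<Rightarrow> int \<Rightarrow> (int set \<times> int set \<times> int set \<times> int set) ring" where
  "quat_ring_mod n a b \<equiv> quaternion_ring (ZFact n) (ZMod n a) (ZMod n b)"

lemma ring_quat_ring_mod: "ring (quat_ring_mod n a b)"
  by (rule ring_quaternion_ring) (simp_all add: ZFact_is_cring carrier_ZFact)

lemma carrier_quat_ring_mod: "carrier (quat_ring_mod n a b) = range (quat_ZMod n)"
  by (auto simp: quaternion_ring_def carrier_ZFact quat_ZMod_def image_iff)

lemma mult_quat_ring_mod:
  "quat_ZMod n x \<otimes>\<^bsub>quat_ring_mod n a b\<^esub> quat_ZMod n y = quat_ZMod n (quat_mult a b x y)"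
  by (auto simp: quaternion_ring_def quat_ZMod_def quat_mult_def ZFact_ZMod_simps split: prod.splits)

lemma add_quat_ring_mod:
  "quat_ZMod n x \<oplus>\<^bsub>quat_ring_mod n a b\<^esub> quat_ZMod n y = quat_ZMod n (quat_add x y)"
  by (auto simp: quaternion_ring_def quat_ZMod_def quat_add_def ZFact_ZMod_simps split: prod.splits)

lemma one_quat_ring_mod: "\<one>\<^bsub>quat_ring_mod n a b\<^esub> = quat_ZMod n (1, 0, 0, 0)"
  by (simp add: quaternion_ring_def quat_ZMod_def ZFact_ZMod_simps)

lemma zero_quat_ring_mod: "\<zero>\<^bsub>quat_ring_mod n a b\<^esub> = quat_ZMod n (0, 0, 0, 0)"
  by (simp add: quaternion_ring_def quat_ZMod_def ZFact_ZMod_simps)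

lemmas quat_ring_mod_simps = mult_quat_ring_mod add_quat_ring_mod one_quat_ring_mod zero_quat_ring_mod

lemma quat_ZMod_eq_iff:
  "quat_ZMod n (x0, x1, x2, x3) = quat_ZMod n (y0, y1, y2, y3) \<longleftrightarrow>
    [x0 = y0] (mod n) \<and> [x1 = y1] (mod n) \<and> [x2 = y2] (mod n) \<and> [x3 = y3] (mod n)"
  by (simp add: quat_ZMod_def ZMod_eq_iff_cong)

text \<open>
  With \<open>I = x1 i + x2 j + x3 k\<close> and \<open>J = y1 i + y2 j + y3 k\<close> in the ring with parameters \<open>c, d\<close>, the
  conditions say \<open>I\<^sup>2 = a\<close>, \<open>J\<^sup>2 = b\<close>, \<open>IJ = -JI\<close>; the last expression is the determinant of
  \<open>(I, J, IJ)\<close> with respect to \<open>(i, j, k)\<close>. Only pure quaternions are needed: if \<open>I\<close> has scalar part \<open>t\<close>,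
  then \<open>I\<^sup>2 = a\<close> makes \<open>2 t\<close> times the pure part of \<open>I\<close> vanish, and that part is unimodular if
  \<open>1, I, J, IJ\<close> is a basis.
\<close>

definition quat_basis ::
  "int \<Rightarrow> int \<Rightarrow> int \<Rightarrow> int \<Rightarrow> int \<Rightarrow> int \<Rightarrow> int \<Rightarrow> int \<Rightarrow> int \<Rightarrow> int \<Rightarrow> int \<Rightarrow> bool" where
  "quat_basis n a b c d x1 x2 x3 y1 y2 y3 \<longleftrightarrow>
     [c * x1\<^sup>2 + d * x2\<^sup>2 - c * d * x3\<^sup>2 = a] (mod n) \<and>
     [c * y1\<^sup>2 + d * y2\<^sup>2 - c * d * y3\<^sup>2 = b] (mod n) \<and>
     [c * x1 * y1 + d * x2 * y2 - c * d * x3 * y3 = 0] (mod n) \<and>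
     coprime ((x1 * y2 - x2 * y1)\<^sup>2 - c * (x3 * y1 - x1 * y3)\<^sup>2 - d * (x2 * y3 - x3 * y2)\<^sup>2) n"

definition quat_equiv :: "int \<Rightarrow> int \<Rightarrow> int \<Rightarrow> int \<Rightarrow> int \<Rightarrow> bool" where
  "quat_equiv n a b c d \<longleftrightarrow> (\<exists>x1 x2 x3 y1 y2 y3. quat_basis n a b c d x1 x2 x3 y1 y2 y3)"

text \<open>The additive map taking 1, i, j, k to 1, \<open>I\<close>, \<open>J\<close>,
  \<open>K\<close>: the candidate for an isomorphism.\<close>

definition quat_lin :: "int4 \<Rightarrow> int4 \<Rightarrow> int4 \<Rightarrow> int4 \<Rightarrow> int4" where
  "quat_lin I J K = (\<lambda>(t0, t1, t2, t3).
     quat_add (quat_add (quat_add (t0, 0, 0, 0) (quat_scale t1 I)) (quat_scale t2 J)) (quat_scale t3 K))"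

lemmas quat_arith_defs = quat_lin_def quat_add_def quat_scale_def quat_mult_def

text \<open>Here \<open>A\<close> = I^2, \<open>B\<close> = J^2, and I J = r + K splits the product
  into scalar and pure part. The number \<open>r\<close> measures the failure of I and J to
  anticommute, so the defect of multiplicativity is a multiple of \<open>r\<close>.\<close>

lemma quat_lin_mult_exact:
  fixes x1 x2 x3 y1 y2 y3 c d :: int
  defines "A \<equiv> c * x1\<^sup>2 + d * x2\<^sup>2 - c * d * x3\<^sup>2"
    and "B \<equiv> c * y1\<^sup>2 + d * y2\<^sup>2 - c * d * y3\<^sup>2"
    and "r \<equiv> c * x1 * y1 + d * x2 * y2 - c * d * x3 * y3"
    and "I \<equiv> (0, x1, x2, x3)" and "J \<equiv> (0, y1, y2, y3)"
    and "K \<equiv> (0, d * (x3 * y2 - x2 * y3), c * (x1 * y3 - x3 * y1), x1 * y2 - x2 * y1)"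
  shows "\<exists>u. quat_mult c d (quat_lin I J K s) (quat_lin I J K t) =
    quat_add (quat_lin I J K (quat_mult A B s t)) (quat_scale r u)"
proof -
  obtain s0 s1 s2 s3 t0 t1 t2 t3 where st: "s = (s0, s1, s2, s3)" "t = (t0, t1, t2, t3)"
    by (metis prod_cases4)
  \<comment> \<open>The defect is collected from I J = r + K, J I = r - K, K^2 = r^2 - A B, I K = A
    J - r I = - K I and K J = B I - r J = - J K.\<close>
  define u where "u = (s1 * t2 + s2 * t1 + r * (s3 * t3),
    (s3 * t1 - s1 * t3) * x1 + (s2 * t3 - s3 * t2) * y1,
    (s3 * t1 - s1 * t3) * x2 + (s2 * t3 - s3 * t2) * y2,
    (s3 * t1 - s1 * t3) * x3 + (s2 * t3 - s3 * t2) * y3)"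
  show ?thesis unfolding st
    by (rule exI[of _ u], simp add: quat_arith_defs u_def I_def J_def K_def)
      (simp add: A_def B_def r_def algebra_simps power2_eq_square)
qed

lemma quat_ZMod_quat_lin_cong:
  assumes "quat_ZMod n s = quat_ZMod n t"
  shows "quat_ZMod n (quat_lin I J K s) = quat_ZMod n (quat_lin I J K t)"
  using assms
  by (cases s; cases t; cases I; cases J; cases K)
    (auto simp: quat_lin_def quat_add_def quat_scale_def quat_ZMod_eq_iff intro!: cong_add cong_mult)

lemma quat_ZMod_quat_mult_cong:
  assumes "[a = a'] (mod n)" "[b = b'] (mod n)"
  shows "quat_ZMod n (quat_mult a b s t) = quat_ZMod n (quat_mult a' b' s t)"
  using assms
  by (cases s; cases t)
    (auto simp: quat_mult_def quat_ZMod_eq_iff intro!: cong_add cong_mult cong_diff)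

lemma quat_ZMod_add_null:
  assumes "[r = 0] (mod n)"
  shows "quat_ZMod n (quat_add s (quat_scale r u)) = quat_ZMod n s"
  using assms
  by (cases s; cases u)
    (auto simp: quat_add_def quat_scale_def quat_ZMod_eq_iff cong_iff_dvd_diff)

lemma quat_lin_add: "quat_lin I J K (quat_add s t) = quat_add (quat_lin I J K s) (quat_lin I J K t)"
  by (cases s; cases t; cases I; cases J; cases K)
    (simp add: quat_lin_def quat_add_def quat_scale_def algebra_simps)

text \<open>A solution of the congruences defines a ring homomorphism, as the defect term
  \<open>r\<close> vanishes modulo \<open>n\<close>. It is injective because its determinant on pure
  quaternions is a unit, and bijective by finiteness.\<close>

lemma quat_equiv_imp_iso:
  assumes "n \<noteq> 0" "quat_equiv n a b c d"
  shows "quat_ring_mod n a b \<simeq> quat_ring_mod n c d"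
proof -
  obtain x1 x2 x3 y1 y2 y3 where
    A: "[c * x1\<^sup>2 + d * x2\<^sup>2 - c * d * x3\<^sup>2 = a] (mod n)" and
    B: "[c * y1\<^sup>2 + d * y2\<^sup>2 - c * d * y3\<^sup>2 = b] (mod n)" and
    r: "[c * x1 * y1 + d * x2 * y2 - c * d * x3 * y3 = 0] (mod n)" and
    cop: "coprime ((x1 * y2 - x2 * y1)\<^sup>2 - c * (x3 * y1 - x1 * y3)\<^sup>2 - d * (x2 * y3 - x3 * y2)\<^sup>2) n"
    using assms(2) unfolding quat_equiv_def quat_basis_def by blast
  define D where "D = (x1 * y2 - x2 * y1)\<^sup>2 - c * (x3 * y1 - x1 * y3)\<^sup>2 - d * (x2 * y3 - x3 * y2)\<^sup>2"
  define H where "H = quat_lin (0, x1, x2, x3) (0, y1, y2, y3)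
    (0, d * (x3 * y2 - x2 * y3), c * (x1 * y3 - x3 * y1), x1 * y2 - x2 * y1)"
  \<comment> \<open>Arbitrary representatives will do, since \<open>H\<close> respects congruence
    modulo \<open>n\<close>.\<close>
  define lift where "lift = (\<lambda>t. SOME x. quat_ZMod n x = t)"
  define h where "h = (\<lambda>t. quat_ZMod n (H (lift t)))"
  have h: "h (quat_ZMod n s) = quat_ZMod n (H s)" for s
  proof -
    have "quat_ZMod n (lift (quat_ZMod n s)) = quat_ZMod n s"
      unfolding lift_def by (rule someI) (rule refl)
    then show ?thesis unfolding h_def H_def by (rule quat_ZMod_quat_lin_cong)
  qed
  have mult: "quat_ZMod n (H (quat_mult a b s t)) = quat_ZMod n (quat_mult c d (H s) (H t))" for s t
  proof -
    let ?A = "c * x1\<^sup>2 + d * x2\<^sup>2 - c * d * x3\<^sup>2" and ?B = "c * y1\<^sup>2 + d * y2\<^sup>2 - c * d * y3\<^sup>2"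
    have "quat_ZMod n (quat_mult a b s t) = quat_ZMod n (quat_mult ?A ?B s t)"
      by (rule quat_ZMod_quat_mult_cong) (use A B in \<open>auto intro: cong_sym\<close>)
    then have "quat_ZMod n (H (quat_mult a b s t)) = quat_ZMod n (H (quat_mult ?A ?B s t))"
      unfolding H_def by (rule quat_ZMod_quat_lin_cong)
    also have "\<dots> = quat_ZMod n (quat_mult c d (H s) (H t))"
      using quat_lin_mult_exact[of c d x1 x2 x3 y1 y2 y3 s t] quat_ZMod_add_null[OF r]
      unfolding H_def by metis
    finally show ?thesis .
  qed
  have H_add: "H (quat_add s t) = quat_add (H s) (H t)" for s t
    unfolding H_def by (rule quat_lin_add)
  have inj: "quat_ZMod n s = quat_ZMod n t" if st: "quat_ZMod n (H s) = quat_ZMod n (H t)" for s t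
  proof -
    obtain s0 s1 s2 s3 t0 t1 t2 t3 where s: "s = (s0, s1, s2, s3)" and t: "t = (t0, t1, t2, t3)"
      by (metis prod_cases4)
    let ?k1 = "d * (x3 * y2 - x2 * y3)" and ?k2 = "c * (x1 * y3 - x3 * y1)" and ?k3 = "x1 * y2 - x2 * y1"
    define u1 u2 u3 where u: "u1 = s1 - t1" "u2 = s2 - t2" "u3 = s3 - t3"
    define v1 v2 v3 where v: "v1 = u1 * x1 + u2 * y1 + u3 * ?k1" "v2 = u1 * x2 + u2 * y2 + u3 * ?k2"
      "v3 = u1 * x3 + u2 * y3 + u3 * ?k3"
    have 0: "[s0 = t0] (mod n)"
      and dv: "n dvd v1" "n dvd v2" "n dvd v3"
      using st by (simp_all add: s t H_def quat_arith_defs quat_ZMod_eq_iff cong_iff_dvd_diff u v algebra_simps)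
    \<comment> \<open>Cramer's rule: the factors of \<open>v1\<close>, \<open>v2\<close>,
      \<open>v3\<close> are cofactors of the matrix with rows I, J, K, whose determinant is
      \<open>D\<close>.\<close>
    have "D * u1 = v1 * (y2 * ?k3 - y3 * ?k2) + v2 * (y3 * ?k1 - y1 * ?k3) + v3 * (y1 * ?k2 - y2 * ?k1)"
      "D * u2 = v1 * (x3 * ?k2 - x2 * ?k3) + v2 * (x1 * ?k3 - x3 * ?k1) + v3 * (x2 * ?k1 - x1 * ?k2)"
      "D * u3 = v1 * (x2 * y3 - x3 * y2) + v2 * (x3 * y1 - x1 * y3) + v3 * (x1 * y2 - x2 * y1)"
      unfolding D_def v by (simp_all add: algebra_simps power2_eq_square)
    then have "n dvd D * u1" "n dvd D * u2" "n dvd D * u3"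
      using dv by simp_all
    moreover have "coprime n D"
      using cop by (simp add: D_def coprime_commute)
    ultimately have "n dvd u1" "n dvd u2" "n dvd u3"
      by (simp_all add: coprime_dvd_mult_right_iff)
    then show ?thesis
      using 0 by (simp add: s t quat_ZMod_eq_iff cong_iff_dvd_diff u)
  qed
  have "h \<in> ring_iso (quat_ring_mod n a b) (quat_ring_mod n c d)"
  proof (rule ring_iso_memI)
    show "h x \<in> carrier (quat_ring_mod n c d)" for x
      by (simp add: carrier_quat_ring_mod h_def)
    show "h (x \<otimes>\<^bsub>quat_ring_mod n a b\<^esub> y) = h x \<otimes>\<^bsub>quat_ring_mod n c d\<^esub> h y"
      and "h (x \<oplus>\<^bsub>quat_ring_mod n a b\<^esub> y) = h x \<oplus>\<^bsub>quat_ring_mod n c d\<^esub> h y"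
      if "x \<in> carrier (quat_ring_mod n a b)" "y \<in> carrier (quat_ring_mod n a b)" for x y
      using that by (auto simp: carrier_quat_ring_mod quat_ring_mod_simps h mult H_add)
    show "h \<one>\<^bsub>quat_ring_mod n a b\<^esub> = \<one>\<^bsub>quat_ring_mod n c d\<^esub>"
      by (simp add: quat_ring_mod_simps h H_def quat_arith_defs)
    have "finite (carrier (quat_ring_mod n a b))"
      using finite_carrier_ZFact[OF assms(1)] by (simp add: quaternion_ring_def)
    moreover have carr: "carrier (quat_ring_mod n a b) = carrier (quat_ring_mod n c d)"
      by (simp add: quaternion_ring_def)
    moreover have "inj_on h (carrier (quat_ring_mod n a b))"
      by (auto simp: inj_on_def carrier_quat_ring_mod h dest: inj)
    moreover have "h ` carrier (quat_ring_mod n a b) \<subseteq> carrier (quat_ring_mod n a b)"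
      by (auto simp: carrier_quat_ring_mod h_def)
    ultimately show "bij_betw h (carrier (quat_ring_mod n a b)) (carrier (quat_ring_mod n c d))"
      by (metis bij_betw_def endo_inj_surj)
  qed
  then show ?thesis by (auto simp: is_ring_iso_def)
qed

text \<open>The matrices with rows u, v, w and with rows i, j, k multiply to the identity modulo
  \<open>n\<close>, so the product of their determinants is 1 modulo \<open>n\<close>.\<close>

lemma coprime_det_of_left_inverse_mod:
  fixes n :: int
  assumes "[u1 * i1 + u2 * j1 + u3 * k1 = 1] (mod n)"
    "[u1 * i2 + u2 * j2 + u3 * k2 = 0] (mod n)"
    "[u1 * i3 + u2 * j3 + u3 * k3 = 0] (mod n)"
    "[v1 * i1 + v2 * j1 + v3 * k1 = 0] (mod n)"
    "[v1 * i2 + v2 * j2 + v3 * k2 = 1] (mod n)"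
    "[v1 * i3 + v2 * j3 + v3 * k3 = 0] (mod n)"
    "[w1 * i1 + w2 * j1 + w3 * k1 = 0] (mod n)"
    "[w1 * i2 + w2 * j2 + w3 * k2 = 0] (mod n)"
    "[w1 * i3 + w2 * j3 + w3 * k3 = 1] (mod n)"
  shows "coprime (i1 * (j2 * k3 - j3 * k2) - i2 * (j1 * k3 - j3 * k1) + i3 * (j1 * k2 - j2 * k1)) n"
    (is "coprime ?D n")
proof -
  define det :: "int \<Rightarrow> int \<Rightarrow> int \<Rightarrow> int \<Rightarrow> int \<Rightarrow> int \<Rightarrow> int \<Rightarrow> int \<Rightarrow> int \<Rightarrow> int" where
    "det a1 a2 a3 b1 b2 b3 c1 c2 c3 = a1 * (b2 * c3 - b3 * c2) - a2 * (b1 * c3 - b3 * c1) + a3 * (b1 * c2 - b2 * c1)"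
    for a1 a2 a3 b1 b2 b3 c1 c2 c3
  have "?D * det u1 u2 u3 v1 v2 v3 w1 w2 w3 =
    det (u1 * i1 + u2 * j1 + u3 * k1) (u1 * i2 + u2 * j2 + u3 * k2) (u1 * i3 + u2 * j3 + u3 * k3)
      (v1 * i1 + v2 * j1 + v3 * k1) (v1 * i2 + v2 * j2 + v3 * k2) (v1 * i3 + v2 * j3 + v3 * k3)
      (w1 * i1 + w2 * j1 + w3 * k1) (w1 * i2 + w2 * j2 + w3 * k2) (w1 * i3 + w2 * j3 + w3 * k3)"
    unfolding det_def by (simp add: algebra_simps)
  also have "[\<dots> = det 1 0 0 0 1 0 0 0 1] (mod n)"
    unfolding det_def by (intro cong_add cong_diff cong_mult assms)
  also have "det 1 0 0 0 1 0 0 0 1 = 1"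
    by (simp add: det_def)
  finally show ?thesis
    by (auto simp: coprime_iff_invertible_int)
qed

text \<open>Every residue class has a nonnegative representative, so upward induction suffices. This
  extends additivity of a homomorphism to integer multiples.\<close>

lemma int_induct_mod:
  fixes n :: int
  assumes "n \<noteq> 0" "P 0" "\<And>k. P k \<Longrightarrow> P (k + 1)" "\<And>k l. [k = l] (mod n) \<Longrightarrow> P k \<Longrightarrow> P l"
  shows "P k"
proof -
  have "P (int m)" for m
  proof (induction m)
    case (Suc m)
    then show ?case using assms(3)[of "int m"] by (simp add: add.commute)
  qed (simp add: assms(2))
  from this[of "nat (k mod \<bar>n\<bar>)"] have "P (k mod \<bar>n\<bar>)"
    using assms(1) by simp
  moreover have "[k mod \<bar>n\<bar> = k] (mod n)"
    by (rule cong_dvd_modulus[of _ _ "\<bar>n\<bar>"]) (simp_all add: cong_def)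
  ultimately show ?thesis using assms(4) by blast
qed

text \<open>The images I and J of i and j are the required pair. Surjectivity makes the determinant
  a unit, which together with oddness removes the scalar parts \<open>i0\<close> and
  \<open>j0\<close>.\<close>

lemma iso_imp_quat_equiv:
  assumes n: "odd n" and iso: "quat_ring_mod n a b \<simeq> quat_ring_mod n c d"
  shows "quat_equiv n a b c d"
proof -
  have n0: "n \<noteq> 0" using n by auto
  let ?P = "quat_ring_mod n a b" and ?Q = "quat_ring_mod n c d"
  let ?q = "quat_ZMod n"
  obtain h where h: "h \<in> ring_hom ?P ?Q" "bij_betw h (carrier ?P) (carrier ?Q)"
    using iso by (auto simp: is_ring_iso_def ring_iso_def)
  have hq: "\<exists>y. h (?q x) = ?q y" for x
    using ring_hom_closed[OF h(1), of "?q x"] by (auto simp: carrier_quat_ring_mod)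
  have h_mult: "h (?q (quat_mult a b x y)) = ?q (quat_mult c d x' y')"
    and h_add: "h (?q (quat_add x y)) = ?q (quat_add x' y')"
    if "h (?q x) = ?q x'" "h (?q y) = ?q y'" for x y x' y'
    using ring_hom_mult[OF h(1), of "?q x" "?q y"] ring_hom_add[OF h(1), of "?q x" "?q y"] that
    by (simp_all add: carrier_quat_ring_mod quat_ring_mod_simps)
  have h_zero: "h (?q (0, 0, 0, 0)) = ?q (0, 0, 0, 0)"
    using ring_hom_zero[OF h(1) ring_quat_ring_mod ring_quat_ring_mod] by (simp add: quat_ring_mod_simps)
  have h_one: "h (?q (1, 0, 0, 0)) = ?q (1, 0, 0, 0)"
    using ring_hom_one[OF h(1)] by (simp add: quat_ring_mod_simps)
  have h_scale: "h (?q (quat_scale k x)) = ?q (quat_scale k x')" if x: "h (?q x) = ?q x'" for k x x'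
  proof (rule int_induct_mod[OF n0, of _ k])
    show "h (?q (quat_scale 0 x)) = ?q (quat_scale 0 x')"
      using h_zero by (cases x; cases x') (simp add: quat_scale_def)
    show "h (?q (quat_scale (k + 1) x)) = ?q (quat_scale (k + 1) x')"
      if "h (?q (quat_scale k x)) = ?q (quat_scale k x')" for k
      using h_add[OF that x] by (cases x; cases x') (simp add: quat_scale_def quat_add_def algebra_simps)
    show "h (?q (quat_scale l x)) = ?q (quat_scale l x')"
      if "[k = l] (mod n)" "h (?q (quat_scale k x)) = ?q (quat_scale k x')" for k l
    proof -
      have "?q (quat_scale k y) = ?q (quat_scale l y)" for y
        using that(1) by (cases y) (auto simp: quat_scale_def quat_ZMod_eq_iff intro!: cong_mult)
      then show ?thesis using that(2) by simp
    qed
  qed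
  have h_const: "h (?q (k, 0, 0, 0)) = ?q (k, 0, 0, 0)" for k
    using h_scale[OF h_one, of k] by (simp add: quat_scale_def)
  obtain I where I: "h (?q (0, 1, 0, 0)) = ?q I" using hq by blast
  obtain J where J: "h (?q (0, 0, 1, 0)) = ?q J" using hq by blast
  define K where "K = quat_mult c d I J"
  have K: "h (?q (0, 0, 0, 1)) = ?q K"
    using h_mult[OF I J] by (simp add: quat_mult_def K_def)
  obtain i0 i1 i2 i3 j0 j1 j2 j3 where
    Ic: "I = (i0, i1, i2, i3)" and Jc: "J = (j0, j1, j2, j3)"
    by (metis prod_cases4)
  have "?q (quat_mult c d I I) = ?q (a, 0, 0, 0)"
    using h_mult[OF I I] h_const[of a] by (simp add: quat_mult_def)
  then have II: "[i0 * i0 + c * (i1 * i1) + d * (i2 * i2) - c * d * (i3 * i3) = a] (mod n)"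
      "n dvd 2 * (i0 * i1)" "n dvd 2 * (i0 * i2)" "n dvd 2 * (i0 * i3)"
    by (simp_all add: Ic quat_mult_def quat_ZMod_eq_iff algebra_simps cong_0_iff)
  have "?q (quat_mult c d J J) = ?q (b, 0, 0, 0)"
    using h_mult[OF J J] h_const[of b] by (simp add: quat_mult_def)
  then have JJ: "[j0 * j0 + c * (j1 * j1) + d * (j2 * j2) - c * d * (j3 * j3) = b] (mod n)"
      "n dvd 2 * (j0 * j1)" "n dvd 2 * (j0 * j2)" "n dvd 2 * (j0 * j3)"
    by (simp_all add: Jc quat_mult_def quat_ZMod_eq_iff algebra_simps cong_0_iff)
  have "?q (quat_add (quat_mult c d I J) (quat_mult c d J I)) = ?q (0, 0, 0, 0)"
    using h_add[OF h_mult[OF I J] h_mult[OF J I]] h_zero by (simp add: quat_mult_def quat_add_def)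
  then have IJ: "n dvd 2 * (i0 * j0 + c * (i1 * j1) + d * (i2 * j2) - c * d * (i3 * j3))"
    by (simp add: Ic Jc quat_add_def quat_mult_def quat_ZMod_eq_iff algebra_simps cong_0_iff)
  \<comment> \<open>Pure coordinates of I J, with the scalar parts of I and J still present.\<close>
  define k1 k2 k3 where kdef: "k1 = i0 * j1 + i1 * j0 + d * (i3 * j2) - d * (i2 * j3)"
    "k2 = i0 * j2 + i2 * j0 + c * (i1 * j3) - c * (i3 * j1)"
    "k3 = i0 * j3 + i3 * j0 + i1 * j2 - i2 * j1"
  have surj: "\<exists>u1 u2 u3. [u1 * i1 + u2 * j1 + u3 * k1 = e1] (mod n) \<and>
    [u1 * i2 + u2 * j2 + u3 * k2 = e2] (mod n) \<and> [u1 * i3 + u2 * j3 + u3 * k3 = e3] (mod n)" for e1 e2 e3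
  proof -
    have "?q (0, e1, e2, e3) \<in> h ` carrier ?P"
      using h(2) by (simp add: bij_betw_def carrier_quat_ring_mod)
    then obtain u where "h (?q u) = ?q (0, e1, e2, e3)"
      by (auto simp: carrier_quat_ring_mod)
    moreover obtain u0 u1 u2 u3 where "u = (u0, u1, u2, u3)"
      by (metis prod_cases4)
    moreover have "h (?q (quat_lin (0, 1, 0, 0) (0, 0, 1, 0) (0, 0, 0, 1) (u0, u1, u2, u3))) =
        ?q (quat_lin I J K (u0, u1, u2, u3))"
      unfolding quat_lin_def prod.case
      by (intro h_add h_scale h_const I J K)
    ultimately have "?q (quat_lin I J K (u0, u1, u2, u3)) = ?q (0, e1, e2, e3)"
      by (simp add: quat_lin_def quat_add_def quat_scale_def)
    then show ?thesis
      by (auto simp: quat_lin_def quat_add_def quat_scale_def quat_mult_def K_def Ic Jc quat_ZMod_eq_iff kdef)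
  qed
  let ?D = "(i1 * j2 - i2 * j1)\<^sup>2 - c * (i3 * j1 - i1 * j3)\<^sup>2 - d * (i2 * j3 - i3 * j2)\<^sup>2"
  \<comment> \<open>The terms of \<open>k1\<close>, \<open>k2\<close>, \<open>k3\<close> containing
    \<open>i0\<close> or \<open>j0\<close> are combinations of the rows I and J and drop out of the
    determinant. \<open>D1\<close> expands it along the row I, \<open>D2\<close> along the row
    J.\<close>
  have D1: "?D = i1 * (j2 * k3 - j3 * k2) - i2 * (j1 * k3 - j3 * k1) + i3 * (j1 * k2 - j2 * k1)"
    unfolding kdef by (simp add: algebra_simps power2_eq_square)
  have D2: "?D = j1 * (i3 * k2 - i2 * k3) + j2 * (i1 * k3 - i3 * k1) + j3 * (i2 * k1 - i1 * k2)"
    unfolding kdef by (simp add: algebra_simps power2_eq_square)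
  obtain u1 u2 u3 v1 v2 v3 w1 w2 w3 where
    "[u1 * i1 + u2 * j1 + u3 * k1 = 1] (mod n)"
    "[u1 * i2 + u2 * j2 + u3 * k2 = 0] (mod n)"
    "[u1 * i3 + u2 * j3 + u3 * k3 = 0] (mod n)"
    "[v1 * i1 + v2 * j1 + v3 * k1 = 0] (mod n)"
    "[v1 * i2 + v2 * j2 + v3 * k2 = 1] (mod n)"
    "[v1 * i3 + v2 * j3 + v3 * k3 = 0] (mod n)"
    "[w1 * i1 + w2 * j1 + w3 * k1 = 0] (mod n)"
    "[w1 * i2 + w2 * j2 + w3 * k2 = 0] (mod n)"
    "[w1 * i3 + w2 * j3 + w3 * k3 = 1] (mod n)"
    using surj[of 1 0 0] surj[of 0 1 0] surj[of 0 0 1] by blast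
  then have cop: "coprime ?D n"
    unfolding D1 by (rule coprime_det_of_left_inverse_mod)
  have two: "n dvd 2 * x \<Longrightarrow> n dvd x" for x
    using n by (simp add: coprime_dvd_mult_right_iff coprime_commute)
  \<comment> \<open>Modulo \<open>n\<close> the scalar \<open>i0\<close> annihilates the row I,
    hence also the determinant expanded along that row, and the determinant is a unit.\<close>
  have "n dvd i0 * ?D"
  proof -
    have "i0 * ?D = (i0 * i1) * (j2 * k3 - j3 * k2) - (i0 * i2) * (j1 * k3 - j3 * k1) + (i0 * i3) * (j1 * k2 - j2 * k1)"
      unfolding D1 by (simp add: algebra_simps)
    then show ?thesis using II(2-4)[THEN two] by simp
  qed
  then have i0: "n dvd i0"
    using cop by (simp add: coprime_dvd_mult_left_iff coprime_commute)
  have "n dvd j0 * ?D"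
  proof -
    have "j0 * ?D = (j0 * j1) * (i3 * k2 - i2 * k3) + (j0 * j2) * (i1 * k3 - i3 * k1) + (j0 * j3) * (i2 * k1 - i1 * k2)"
      unfolding D2 by (simp add: algebra_simps)
    then show ?thesis using JJ(2-4)[THEN two] by simp
  qed
  then have j0: "n dvd j0"
    using cop by (simp add: coprime_dvd_mult_left_iff coprime_commute)
  have "[c * i1\<^sup>2 + d * i2\<^sup>2 - c * d * i3\<^sup>2 = a] (mod n)"
  proof -
    have "n dvd (i0 * i0 + c * (i1 * i1) + d * (i2 * i2) - c * d * (i3 * i3) - a) - i0 * i0"
      using II(1) i0 by - (rule dvd_diff, simp_all add: cong_iff_dvd_diff)
    then show ?thesis by (simp add: cong_iff_dvd_diff power2_eq_square algebra_simps)
  qed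
  moreover have "[c * j1\<^sup>2 + d * j2\<^sup>2 - c * d * j3\<^sup>2 = b] (mod n)"
  proof -
    have "n dvd (j0 * j0 + c * (j1 * j1) + d * (j2 * j2) - c * d * (j3 * j3) - b) - j0 * j0"
      using JJ(1) j0 by - (rule dvd_diff, simp_all add: cong_iff_dvd_diff)
    then show ?thesis by (simp add: cong_iff_dvd_diff power2_eq_square algebra_simps)
  qed
  moreover have "[c * i1 * j1 + d * i2 * j2 - c * d * i3 * j3 = 0] (mod n)"
  proof -
    have "n dvd (i0 * j0 + c * (i1 * j1) + d * (i2 * j2) - c * d * (i3 * j3)) - i0 * j0"
      using two[OF IJ] i0 by - (rule dvd_diff, simp_all)
    then show ?thesis by (simp add: cong_0_iff algebra_simps)
  qed
  ultimately show ?thesis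
    unfolding quat_equiv_def quat_basis_def using cop by blast
qed

lemma quat_equiv_iff_iso:
  assumes "odd n"
  shows "quat_equiv n a b c d \<longleftrightarrow> quat_ring_mod n a b \<simeq> quat_ring_mod n c d"
  using assms quat_equiv_imp_iso[of n a b c d] iso_imp_quat_equiv[of n a b c d] by auto

section \<open>Squares modulo odd prime powers\<close>

lemma inverse_mod_prime_power:
  fixes p a :: int
  assumes "prime p" "\<not> p dvd a"
  obtains b where "[a * b = 1] (mod p ^ s)" "\<not> p dvd b"
proof -
  have "coprime a p"
    using prime_imp_coprime[OF assms] by (simp add: coprime_commute)
  \<comment> \<open>The exponent \<open>Suc s\<close> keeps reduction modulo \<open>p\<close>
    available when \<open>s\<close> is 0.\<close>
  then have "coprime a (p ^ Suc s)"
    by simp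
  then obtain b where b: "[a * b = 1] (mod p ^ Suc s)"
    using cong_solve_coprime_int by blast
  have "[a * b = 1] (mod p)" "[a * b = 1] (mod p ^ s)"
    using b by (auto intro: cong_dvd_modulus simp del: power_Suc simp: le_imp_power_dvd)
  moreover from this(1) have "\<not> p dvd b"
    using assms(1) by (metis cong_dvd_iff dvd_mult not_prime_unit)
  ultimately show thesis using that by blast
qed

text \<open>Hensel lifting: a root modulo \<open>p\<close> is refined by Newton steps, since the
  derivative \<open>2 * z\<close> is a unit.\<close>

lemma square_mod_prime_power:
  fixes p u :: int
  assumes p: "prime p" "odd p" and u: "\<not> p dvd u" and QR: "QuadRes p u"
  shows "\<exists>z. \<not> p dvd z \<and> [u = z\<^sup>2] (mod p ^ s)"
proof -
  have "\<exists>z. \<not> p dvd z \<and> [u = z\<^sup>2] (mod p ^ Suc s)"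
  proof (induction s)
    case 0
    obtain y where y: "[y\<^sup>2 = u] (mod p)" using QR by (auto simp: QuadRes_def)
    then have "\<not> p dvd y"
      using u cong_dvd_iff[OF y] by (auto simp: power2_eq_square)
    with y show ?case by (auto intro: cong_sym)
  next
    case (Suc s)
    then obtain z where z: "\<not> p dvd z" "[u = z\<^sup>2] (mod p ^ Suc s)" by blast
    obtain w where w: "u - z\<^sup>2 = p ^ Suc s * w"
      using z(2) by (auto simp: cong_iff_dvd_diff)
    have "\<not> p dvd 2"
      using p prime_ge_2_int[of p] by (auto dest: zdvd_imp_le)
    have "\<not> p dvd 2 * z"
      using p z(1) \<open>\<not> p dvd 2\<close> by (simp add: prime_dvd_mult_iff)
    then obtain b where b: "[2 * z * b = 1] (mod p ^ 1)"
      using p(1) inverse_mod_prime_power by blast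
    have "p dvd 2 * z * b - 1"
      using b by (simp add: cong_iff_dvd_diff)
    then obtain q where "2 * z * b - 1 = p * q" by (rule dvdE)
    then have q: "2 * z * b = 1 + p * q" by linarith
    \<comment> \<open>Here \<open>b\<close> inverts the derivative \<open>2 * z\<close> modulo
      \<open>p\<close>, so the correction cancels the error \<open>p ^ Suc s * w\<close> up to the
      next power of \<open>p\<close>.\<close>
    define y where "y = z + b * w * p ^ Suc s"
    have "u - y\<^sup>2 = p ^ Suc s * w - 2 * z * b * (w * p ^ Suc s) - b\<^sup>2 * w\<^sup>2 * (p ^ Suc s * p ^ Suc s)"
      using w unfolding y_def by (simp only: power2_eq_square) (simp add: algebra_simps)
    also have "\<dots> = p ^ Suc (Suc s) * (- (q * w) - b\<^sup>2 * w\<^sup>2 * p ^ s)"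
      unfolding q by (simp add: algebra_simps)
    finally have "[u = y\<^sup>2] (mod p ^ Suc (Suc s))"
      by (simp only: cong_iff_dvd_diff) simp
    moreover have "\<not> p dvd y"
      using z(1) unfolding y_def by (simp add: dvd_add_left_iff)
    ultimately show ?case by blast
  qed
  then show ?thesis
    by (metis cong_dvd_modulus le_imp_power_dvd lessI less_imp_le)
qed

text \<open>By Euler's criterion the Legendre symbol is multiplicative modulo \<open>p\<close>, and
  (-1)(-1) = 1.\<close>

lemma QuadRes_mult_nonresidues:
  fixes p u v :: int
  assumes p: "prime p" "odd p" and "\<not> QuadRes p u" "\<not> QuadRes p v"
  shows "QuadRes p (u * v)"
proof -
  have p2: "2 < p"
    using p prime_ge_2_int[of p] by (cases "p = 2") auto
  define P where "P = nat p"
  have P: "prime P" "2 < P" "int P = p"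
    using p p2 by (auto simp: P_def)
  note eu = euler_criterion[OF P(1,2), unfolded P(3)]
  have nz: "\<not> [u = 0] (mod p)" "\<not> [v = 0] (mod p)"
    using assms(3,4) unfolding QuadRes_def
    by (metis cong_sym zero_power2)+
  have "[Legendre (u * v) p = u ^ ((P - 1) div 2) * v ^ ((P - 1) div 2)] (mod p)"
    using eu[of "u * v"] by (simp add: power_mult_distrib)
  also have "[u ^ ((P - 1) div 2) * v ^ ((P - 1) div 2) = Legendre u p * Legendre v p] (mod p)"
    by (intro cong_mult cong_sym[OF eu])
  also have "Legendre u p * Legendre v p = 1"
    using nz assms(3,4) by (simp add: Legendre_def)
  finally have "[Legendre (u * v) p = 1] (mod p)" .
  moreover have "\<not> [-1 = 1] (mod p)" "\<not> [0 = 1] (mod p)"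
    using p2 by (auto simp: cong_iff_dvd_diff dest: zdvd_imp_le)
  ultimately show ?thesis
    by (auto simp: Legendre_def split: if_splits)
qed

text \<open>The least positive nonresidue \<open>e\<close> works, since \<open>e - 1\<close> is then a residue.\<close>

lemma nonresidue_one_plus_square:
  fixes p :: int
  assumes p: "prime p" "odd p"
  obtains e r where "\<not> QuadRes p e" "\<not> p dvd e" "[e = r\<^sup>2 + 1] (mod p)"
proof -
  have p2: "2 < p"
    using p prime_ge_2_int[of p] by (cases "p = 2") auto
  have dvd_QR: "QuadRes p x" if "p dvd x" for x
    using that by (auto simp: QuadRes_def cong_0_iff intro!: exI[of _ 0] cong_sym[of x])
  \<comment> \<open>If every residue were a square, squaring would permute \<open>{0..<p}\<close>,
    but 1 and \<open>p - 1\<close> have the same square.\<close>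
  have "\<exists>m::nat. \<not> QuadRes p (int m)"
  proof (rule ccontr)
    assume all: "\<nexists>m::nat. \<not> QuadRes p (int m)"
    define f where "f = (\<lambda>x. x\<^sup>2 mod p)"
    have "f ` {0..<p} = {0..<p}"
    proof
      show "f ` {0..<p} \<subseteq> {0..<p}" using p2 by (auto simp: f_def)
      show "{0..<p} \<subseteq> f ` {0..<p}"
      proof
        fix y assume y: "y \<in> {0..<p}"
        then have "QuadRes p (int (nat y))" using all by blast
        then obtain x where "[x\<^sup>2 = y] (mod p)" using y by (auto simp: QuadRes_def)
        then have "f (x mod p) = y"
          using y by (simp add: f_def cong_def power_mod)
        then show "y \<in> f ` {0..<p}"
          using p2 by (auto intro!: image_eqI[of _ _ "x mod p"])
      qed
    qed
    then have "inj_on f {0..<p}"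
      by (intro eq_card_imp_inj_on) auto
    moreover have "f 1 = f (p - 1)"
    proof -
      have "(p - 1)\<^sup>2 = 1 + p * (p - 2)"
        by (simp add: power2_eq_square algebra_simps)
      then show ?thesis by (simp add: f_def)
    qed
    ultimately show False
      using p2 by (auto dest: inj_onD[of _ _ 1 "p - 1"])
  qed
  then obtain m where m: "\<not> QuadRes p (int m)" "\<And>k. k < m \<Longrightarrow> QuadRes p (int k)"
    using exists_least_iff[of "\<lambda>m. \<not> QuadRes p (int m)"] by blast
  have "m \<noteq> 0" using m(1) dvd_QR[of 0] by (metis dvd_0_right of_nat_0)
  then have "QuadRes p (int (m - 1))" by (intro m(2)) simp
  then obtain r where "[r\<^sup>2 = int (m - 1)] (mod p)" by (auto simp: QuadRes_def)
  then have "[r\<^sup>2 + 1 = int (m - 1) + 1] (mod p)" by (rule cong_add) simp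
  then have "[int m = r\<^sup>2 + 1] (mod p)" using \<open>m \<noteq> 0\<close> by (simp add: cong_sym of_nat_diff)
  then show thesis using that m(1) dvd_QR by blast
qed

text \<open>For a nonresidue \<open>u\<close> the product \<open>u * e\<close> is a residue, hence a
  square z^2 modulo \<open>p ^ s\<close>, and u = e (z / e)^2.\<close>

lemma unit_square_class_cases:
  fixes p e u :: int
  assumes p: "prime p" "odd p" and e: "\<not> QuadRes p e" "\<not> p dvd e" and u: "\<not> p dvd u"
  obtains w x where "w \<in> {1, e}" "\<not> p dvd x" "[u = w * x\<^sup>2] (mod p ^ s)"
proof (cases "QuadRes p u")
  case True
  from square_mod_prime_power[OF p u True] show thesis
    using that[of 1] by auto
next
  case False
  have ue: "\<not> p dvd u * e"
    using p(1) u e(2) by (simp add: prime_dvd_mult_iff)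
  obtain z where z: "\<not> p dvd z" "[u * e = z\<^sup>2] (mod p ^ s)"
    using square_mod_prime_power[OF p ue QuadRes_mult_nonresidues[OF p False e(1)]] by blast
  obtain b where b: "[e * b = 1] (mod p ^ s)" "\<not> p dvd b"
    using inverse_mod_prime_power[OF p(1) e(2)] .
  have "[u * 1 * 1 = u * (e * b) * (e * b)] (mod p ^ s)"
    by (intro cong_mult cong_refl cong_sym[OF b(1)])
  also have "u * (e * b) * (e * b) = (u * e) * (e * b\<^sup>2)"
    by (simp add: power2_eq_square)
  also have "[(u * e) * (e * b\<^sup>2) = z\<^sup>2 * (e * b\<^sup>2)] (mod p ^ s)"
    by (intro cong_mult z(2) cong_refl)
  also have "z\<^sup>2 * (e * b\<^sup>2) = e * (z * b)\<^sup>2"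
    by (simp add: power2_eq_square)
  finally have "[u = e * (z * b)\<^sup>2] (mod p ^ s)" by simp
  moreover have "\<not> p dvd z * b"
    using p(1) z(1) b(2) by (simp add: prime_dvd_mult_iff)
  ultimately show thesis using that[of e] by blast
qed

text \<open>If 1 = e x^2, then e = (e x)^2 is a residue; if e = x^2, this is immediate.\<close>

lemma square_class_unique:
  fixes p e u v x :: int
  assumes "\<not> QuadRes p e" "u \<in> {1, e}" "v \<in> {1, e}" "[u = v * x\<^sup>2] (mod p)"
  shows "u = v"
proof (rule ccontr)
  assume "u \<noteq> v"
  then consider "u = 1" "v = e" | "u = e" "v = 1" using assms(2,3) by blast
  then show False
  proof cases
    case 1
    then have "[1 * e = e * x\<^sup>2 * e] (mod p)"
      using assms(4) by (intro cong_mult) auto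
    then have "[(e * x)\<^sup>2 = e] (mod p)"
      by (simp add: power2_eq_square mult_ac cong_sym)
    then show ?thesis using assms(1) by (auto simp: QuadRes_def)
  next
    case 2
    then show ?thesis using assms(1,4) by (auto simp: QuadRes_def intro: cong_sym)
  qed
qed

text \<open>If one coefficient is a square, the other variable is set to 0. Otherwise rescaling
  gives e (X^2 + Y^2), and X = r, Y = 1 works because e (r^2 + 1) is e^2 modulo \<open>p\<close>, a
  unit square that lifts.\<close>

lemma binary_form_represents_unit_square:
  fixes p \<alpha> \<beta> :: int
  assumes p: "prime p" "odd p" and u: "\<not> p dvd \<alpha>" "\<not> p dvd \<beta>"
  obtains x y z where "\<not> p dvd z" "[\<alpha> * x\<^sup>2 + \<beta> * y\<^sup>2 = z\<^sup>2] (mod p ^ s)"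
proof -
  obtain e r where e: "\<not> QuadRes p e" "\<not> p dvd e" and r: "[e = r\<^sup>2 + 1] (mod p)"
    using nonresidue_one_plus_square[OF p] .
  obtain v a where v: "v \<in> {1, e}" "\<not> p dvd a" "[\<alpha> = v * a\<^sup>2] (mod p ^ s)"
    using unit_square_class_cases[OF p e u(1)] .
  obtain w b where w: "w \<in> {1, e}" "\<not> p dvd b" "[\<beta> = w * b\<^sup>2] (mod p ^ s)"
    using unit_square_class_cases[OF p e u(2)] .
  consider "v = 1" | "w = 1" | "v = e" "w = e" using v(1) w(1) by blast
  then show thesis
  proof cases
    case 1
    then show thesis using that[of a 1 0] v by simp
  next
    case 2
    then show thesis using that[of b 0 1] w by simp
  next
    case 3
    obtain a' where a': "[a * a' = 1] (mod p ^ s)"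
      using inverse_mod_prime_power[OF p(1) v(2)] by blast
    obtain b' where b': "[b * b' = 1] (mod p ^ s)"
      using inverse_mod_prime_power[OF p(1) w(2)] by blast
    have "\<not> p dvd e * (r\<^sup>2 + 1)"
      using p(1) e(2) cong_dvd_iff[OF r] by (simp add: prime_dvd_mult_iff)
    moreover have "QuadRes p (e * (r\<^sup>2 + 1))"
    proof -
      have "[e * e = e * (r\<^sup>2 + 1)] (mod p)"
        by (intro cong_mult cong_refl r)
      then show ?thesis by (auto simp: QuadRes_def power2_eq_square)
    qed
    ultimately obtain z where z: "\<not> p dvd z" "[e * (r\<^sup>2 + 1) = z\<^sup>2] (mod p ^ s)"
      using square_mod_prime_power[OF p] by blast
    have "[\<alpha> * (r * a')\<^sup>2 + \<beta> * b'\<^sup>2 = e * a\<^sup>2 * (r * a')\<^sup>2 + e * b\<^sup>2 * b'\<^sup>2] (mod p ^ s)"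
      using v(3) w(3) 3 by (intro cong_add cong_mult) auto
    also have "e * a\<^sup>2 * (r * a')\<^sup>2 + e * b\<^sup>2 * b'\<^sup>2 = e * (r\<^sup>2 * (a * a')\<^sup>2 + (b * b')\<^sup>2)"
      by (simp add: power2_eq_square algebra_simps)
    also have "[\<dots> = e * (r\<^sup>2 * 1\<^sup>2 + 1\<^sup>2)] (mod p ^ s)"
      by (intro cong_add cong_mult cong_pow cong_refl a' b')
    also have "e * (r\<^sup>2 * 1\<^sup>2 + 1\<^sup>2) = e * (r\<^sup>2 + 1)" by simp
    also note z(2)
    finally show thesis using that z(1) by blast
  qed
qed

section \<open>Elementary isomorphisms and invariants\<close>

lemma quat_equiv_cong:
  assumes "[a = a'] (mod n)" "[b = b'] (mod n)"
  shows "quat_equiv n a b a' b'"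
proof -
  have "quat_basis n a b a' b' 1 0 0 0 1 0"
    using assms by (simp add: quat_basis_def cong_sym)
  then show ?thesis unfolding quat_equiv_def by blast
qed

lemma quat_equiv_swap: "quat_equiv n a b b a"
proof -
  have "quat_basis n a b b a 0 1 0 1 0 0"
    by (simp add: quat_basis_def)
  then show ?thesis unfolding quat_equiv_def by blast
qed

lemma quat_equiv_scale:
  assumes "coprime x n" "coprime y n" "[a = c * x\<^sup>2] (mod n)" "[b = d * y\<^sup>2] (mod n)"
  shows "quat_equiv n a b c d"
proof -
  have "quat_basis n a b c d x 0 0 0 y 0"
    using assms by (simp add: quat_basis_def cong_sym)
  then show ?thesis unfolding quat_equiv_def by blast
qed

text \<open>Replaces \<open>j\<close> by \<open>(x + y i) j\<close>, multiplying \<open>j\<^sup>2\<close> by the norm \<open>x\<^sup>2 - a y\<^sup>2\<close>.\<close>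

lemma quat_equiv_norm:
  assumes "[v * x\<^sup>2 - a * v * y\<^sup>2 = z\<^sup>2] (mod n)" "coprime z n"
  shows "quat_equiv n a (m * z\<^sup>2) a (m * v)"
proof -
  have "[m * (v * x\<^sup>2 - a * v * y\<^sup>2) = m * z\<^sup>2] (mod n)"
    by (intro cong_mult cong_refl assms)
  \<comment> \<open>This is the determinant for I = i and J = x j + y k; it is a factor of the unit
    z^2 modulo \<open>n\<close>.\<close>
  moreover have "coprime (x\<^sup>2 - a * y\<^sup>2) n"
  proof -
    have "coprime (v * x\<^sup>2 - a * v * y\<^sup>2) n"
      using assms by (metis cong_imp_coprime cong_sym coprime_power_left_iff)
    also have "v * x\<^sup>2 - a * v * y\<^sup>2 = v * (x\<^sup>2 - a * y\<^sup>2)"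
      by (simp add: algebra_simps)
    finally show ?thesis by simp
  qed
  ultimately have "quat_basis n a (m * z\<^sup>2) a (m * v) 1 0 0 0 x y"
    by (simp add: quat_basis_def algebra_simps)
  then show ?thesis unfolding quat_equiv_def by blast
qed

text \<open>Replaces \<open>i\<close> by \<open>x i + y j\<close> and \<open>j\<close> by the orthogonal vector \<open>u x j - v y i\<close>.\<close>

lemma quat_equiv_binary:
  assumes "[u * x\<^sup>2 + v * y\<^sup>2 = z\<^sup>2] (mod n)" "coprime z n"
  shows "quat_equiv n (m * z\<^sup>2) (m * u * v * z\<^sup>2) (m * u) (m * v)"
proof -
  have "[m * (u * x\<^sup>2 + v * y\<^sup>2) = m * z\<^sup>2] (mod n)"
    "[m * u * v * (u * x\<^sup>2 + v * y\<^sup>2) = m * u * v * z\<^sup>2] (mod n)"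
    by (intro cong_mult cong_refl assms)+
  moreover have "coprime (u * x\<^sup>2 + v * y\<^sup>2) n"
    using assms by (metis cong_imp_coprime cong_sym coprime_power_left_iff)
  then have "coprime ((x * (u * x) - y * (- v * y))\<^sup>2) n"
    by (simp add: power2_eq_square mult_ac)
  ultimately have "quat_basis n (m * z\<^sup>2) (m * u * v * z\<^sup>2) (m * u) (m * v) x y 0 (- v * y) (u * x) 0"
    unfolding quat_basis_def
    by (intro conjI; simp only: mult_zero_left mult_zero_right diff_zero zero_power2)
      (simp_all add: algebra_simps power2_eq_square)
  then show ?thesis unfolding quat_equiv_def by blast
qed

section \<open>Invariants modulo prime powers: exponents and square classes\<close>

lemma power_dvd_power_mult_unit:
  fixes p u :: int
  assumes "prime p" "\<not> p dvd u" "p ^ k dvd p ^ i * u"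
  shows "k \<le> i"
proof (rule ccontr)
  assume "\<not> k \<le> i"
  then have "p ^ i * p dvd p ^ i * u"
    using assms(3) by (metis dvd_trans le_imp_power_dvd not_less_eq_eq power_Suc2)
  then show False using assms(1,2) by auto
qed

text \<open>As i' \<le> j', the power \<open>p ^ i'\<close> divides all three coefficients of the
  ternary form of the second ring, hence every value of it, in particular the square of I.\<close>

lemma quat_equiv_first_valuation_le:
  fixes p :: int
  assumes "prime p" "\<not> p dvd u" "i' \<le> j'" "i' \<le> s"
    and "quat_equiv (p ^ s) (p ^ i * u) b (p ^ i' * u') (p ^ j' * v')"
  shows "i' \<le> i"
proof -
  obtain x1 x2 x3 where
    "[p ^ i' * u' * x1\<^sup>2 + p ^ j' * v' * x2\<^sup>2 - p ^ i' * u' * (p ^ j' * v') * x3\<^sup>2 = p ^ i * u] (mod p ^ s)"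
    using assms(5) unfolding quat_equiv_def quat_basis_def by blast
  then have "[p ^ i' * u' * x1\<^sup>2 + p ^ j' * v' * x2\<^sup>2 - p ^ i' * u' * (p ^ j' * v') * x3\<^sup>2 = p ^ i * u] (mod p ^ i')"
    by (rule cong_dvd_modulus) (simp add: le_imp_power_dvd assms(4))
  moreover have "p ^ i' dvd p ^ i' * u' * x1\<^sup>2 + p ^ j' * v' * x2\<^sup>2 - p ^ i' * u' * (p ^ j' * v') * x3\<^sup>2"
    using assms(3) by (intro dvd_add dvd_diff) (auto simp: le_imp_power_dvd intro: dvd_mult2)
  ultimately have "p ^ i' dvd p ^ i * u"
    using cong_dvd_iff by blast
  then show ?thesis
    by (rule power_dvd_power_mult_unit[OF assms(1,2)])
qed

text \<open>Once \<open>c * d\<close> vanishes modulo \<open>p ^ k\<close>, the coordinates along k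
  contribute nothing and the ternary form becomes binary.\<close>

lemma quat_equiv_drop_third:
  fixes p :: int
  assumes "k \<le> s" "p ^ k dvd c * d" and "quat_equiv (p ^ s) a b c d"
  obtains x1 x2 y1 y2 where "[c * x1\<^sup>2 + d * x2\<^sup>2 = a] (mod p ^ k)"
    "[c * y1\<^sup>2 + d * y2\<^sup>2 = b] (mod p ^ k)" "[c * x1 * y1 + d * x2 * y2 = 0] (mod p ^ k)"
proof -
  have ps: "p ^ k dvd p ^ s" using assms(1) by (rule le_imp_power_dvd)
  obtain x1 x2 x3 y1 y2 y3 where *:
    "[c * x1\<^sup>2 + d * x2\<^sup>2 - c * d * x3\<^sup>2 = a] (mod p ^ s)"
    "[c * y1\<^sup>2 + d * y2\<^sup>2 - c * d * y3\<^sup>2 = b] (mod p ^ s)"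
    "[c * x1 * y1 + d * x2 * y2 - c * d * x3 * y3 = 0] (mod p ^ s)"
    using assms(3) unfolding quat_equiv_def quat_basis_def by blast
  have red: "[t = e] (mod p ^ k)" if "[t - c * d * g = e] (mod p ^ s)" for t e g
  proof -
    have "p ^ k dvd t - c * d * g - e"
      using that ps by (auto simp: cong_iff_dvd_diff intro: dvd_trans)
    moreover have "p ^ k dvd c * d * g" using assms(2) by (rule dvd_mult2)
    ultimately have "p ^ k dvd (t - c * d * g - e) + c * d * g" by (rule dvd_add)
    then show ?thesis by (simp add: cong_iff_dvd_diff)
  qed
  show thesis
    using that red[OF *(1)] red[OF *(2)] red[of "c * x1 * y1 + d * x2 * y2" "x3 * y3" 0] *(3)
    by (simp add: mult.assoc)
qed

text \<open>Both coefficients containing the second parameter vanish modulo \<open>p ^ k\<close>, so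
  only the coordinates along i survive.\<close>

lemma quat_equiv_drop_second:
  fixes p :: int
  assumes "k \<le> s" "k \<le> j'"
    and eq: "quat_equiv (p ^ s) a b c (p ^ j' * v')"
  obtains x1 y1 where "[c * x1\<^sup>2 = a] (mod p ^ k)" "[c * y1\<^sup>2 = b] (mod p ^ k)"
    "[c * x1 * y1 = 0] (mod p ^ k)"
proof -
  have d: "p ^ k dvd p ^ j' * v'"
    using assms(2) by (simp add: le_imp_power_dvd)
  have red: "[t = e] (mod p ^ k)" if "[t + p ^ j' * v' * f = e] (mod p ^ k)" for t e f
  proof -
    have "p ^ k dvd p ^ j' * v' * f" using d by (rule dvd_mult2)
    then have "p ^ k dvd (t + p ^ j' * v' * f - e) - p ^ j' * v' * f"
      using that by - (rule dvd_diff, simp_all only: cong_iff_dvd_diff)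
    then show ?thesis by (simp add: cong_iff_dvd_diff)
  qed
  obtain x1 x2 y1 y2 where
    x: "[c * x1\<^sup>2 + p ^ j' * v' * x2\<^sup>2 = a] (mod p ^ k)" and
    y: "[c * y1\<^sup>2 + p ^ j' * v' * y2\<^sup>2 = b] (mod p ^ k)" and
    xy: "[c * x1 * y1 + p ^ j' * v' * x2 * y2 = 0] (mod p ^ k)"
    by (rule quat_equiv_drop_third[OF assms(1) dvd_mult[OF d] eq])
  have "[c * x1 * y1 + p ^ j' * v' * (x2 * y2) = 0] (mod p ^ k)"
    using xy by (simp only: mult.assoc)
  then show thesis
    by (rule that[OF red[OF x] red[OF y] red])
qed

lemma cong_power_cancel:
  fixes p :: int
  assumes "p \<noteq> 0" "[p ^ i * x = p ^ i * y] (mod p ^ (i + k))"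
  shows "[x = y] (mod p ^ k)"
  using assms by (simp add: cong_iff_dvd_diff power_add flip: right_diff_distrib)

text \<open>Suppose j < j' and reduce modulo \<open>p ^ j'\<close>. Then the coordinate
  \<open>x1\<close> of I is a unit, orthogonality makes p^i u' y1 vanish, and so
  \<open>p ^ j * v\<close> would vanish too.\<close>

lemma quat_equiv_second_valuation_le:
  fixes p :: int
  assumes p: "prime p" and u: "\<not> p dvd u" and v: "\<not> p dvd v"
    and ij: "i \<le> j" "j' \<le> s"
    and eq: "quat_equiv (p ^ s) (p ^ i * u) (p ^ j * v) (p ^ i * u') (p ^ j' * v')"
  shows "j' \<le> j"
proof (rule ccontr)
  assume less: "\<not> j' \<le> j"
  obtain x1 y1 where
    x: "[p ^ i * u' * x1\<^sup>2 = p ^ i * u] (mod p ^ j')" and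
    y: "[p ^ i * u' * y1\<^sup>2 = p ^ j * v] (mod p ^ j')" and
    xy: "[p ^ i * u' * x1 * y1 = 0] (mod p ^ j')"
    using quat_equiv_drop_second[OF ij(2) order_refl eq] .
  have p0: "p \<noteq> 0" using p by auto
  \<comment> \<open>Since i \<le> j < j', at least one power of \<open>p\<close> remains after
    \<open>p ^ i\<close> is cancelled.\<close>
  obtain k where k: "j' = i + Suc k"
    using less ij(1) less_iff_Suc_add[of i j'] by auto
  have "[p ^ i * (u' * x1\<^sup>2) = p ^ i * u] (mod p ^ (i + Suc k))"
    using x unfolding k by (simp only: mult.assoc)
  then have "[u' * x1\<^sup>2 = u] (mod p ^ Suc k)"
    by (rule cong_power_cancel[OF p0])
  then have "[u' * x1\<^sup>2 = u] (mod p)"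
    by (rule cong_dvd_modulus) simp
  then have "\<not> p dvd u' * x1\<^sup>2"
    using u cong_dvd_iff by blast
  then have "\<not> p dvd x1" by (auto simp: power2_eq_square)
  then have cop: "coprime (p ^ j') x1"
    using p by (simp add: prime_imp_coprime)
  have "p ^ j' dvd x1 * (p ^ i * u' * y1)"
    using xy by (simp add: cong_0_iff mult_ac)
  then have "p ^ j' dvd p ^ i * u' * y1"
    using cop by (simp add: coprime_dvd_mult_right_iff)
  then have "p ^ j' dvd p ^ i * u' * y1\<^sup>2"
    by (simp add: power2_eq_square flip: mult.assoc)
  then have "p ^ j' dvd p ^ j * v"
    using y cong_dvd_iff by blast
  then show False
    using power_dvd_power_mult_unit[OF p v] less by blast
qed

text \<open>Modulo \<open>p ^ (i + 1)\<close> only the first coefficient survives; cancelling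
  \<open>p ^ i\<close> leaves a congruence modulo \<open>p\<close>.\<close>

lemma quat_equiv_first_unit:
  fixes p :: int
  assumes p: "prime p" and ij: "i < j'" "i < s"
    and eq: "quat_equiv (p ^ s) (p ^ i * u) b (p ^ i * u') (p ^ j' * v')"
  obtains x where "[u = u' * x\<^sup>2] (mod p)"
proof -
  obtain x1 y1 where
    x: "[p ^ i * u' * x1\<^sup>2 = p ^ i * u] (mod p ^ (i + 1))"
    by (rule quat_equiv_drop_second[OF _ _ eq, of "i + 1"]) (use ij in auto)
  have p0: "p \<noteq> 0" using p by auto
  have "[p ^ i * (u' * x1\<^sup>2) = p ^ i * u] (mod p ^ (i + 1))"
    using x by (simp only: mult.assoc)
  then have "[u' * x1\<^sup>2 = u] (mod p ^ 1)"
    by (rule cong_power_cancel[OF p0])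
  then have "[u' * x1\<^sup>2 = u] (mod p)" by simp
  then show thesis by (rule that[OF cong_sym])
qed

text \<open>Modulo \<open>p ^ (j + 1)\<close> the coordinates along k vanish because 0 < i. Since
  \<open>u' * x1\<close> is a unit, orthogonality forces p^(j - i) to divide \<open>y1\<close>. Then
  p^i y1^2 is divisible by p^(2 j - i), hence by \<open>p ^ (j + 1)\<close>, and only v' y2^2
  remains.\<close>

lemma quat_equiv_second_unit:
  fixes p :: int
  assumes p: "prime p" and u: "\<not> p dvd u" and ij: "0 < i" "i < j" "j < s"
    and eq: "quat_equiv (p ^ s) (p ^ i * u) (p ^ j * v) (p ^ i * u') (p ^ j * v')"
  obtains x where "[v = v' * x\<^sup>2] (mod p)"
proof -
  have p0: "p \<noteq> 0" using p by auto
  define k where "k = j - i"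
  have k: "j = i + k" "0 < k" using ij by (auto simp: k_def)
  have "p ^ (j + 1) dvd p ^ (i + j)"
    using ij by (intro le_imp_power_dvd) simp
  then have "p ^ (j + 1) dvd p ^ (i + j) * (u' * v')"
    by (rule dvd_mult2)
  then have dv: "p ^ (j + 1) dvd p ^ i * u' * (p ^ j * v')"
    by (simp add: power_add mult_ac)
  obtain x1 x2 y1 y2 where
    x: "[p ^ i * u' * x1\<^sup>2 + p ^ j * v' * x2\<^sup>2 = p ^ i * u] (mod p ^ (j + 1))" and
    y: "[p ^ i * u' * y1\<^sup>2 + p ^ j * v' * y2\<^sup>2 = p ^ j * v] (mod p ^ (j + 1))" and
    xy: "[p ^ i * u' * x1 * y1 + p ^ j * v' * x2 * y2 = 0] (mod p ^ (j + 1))"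
    by (rule quat_equiv_drop_third[OF _ dv eq]) (use ij in auto)
  have "[p ^ i * (u' * x1\<^sup>2 + p ^ k * v' * x2\<^sup>2) = p ^ i * u] (mod p ^ (i + (k + 1)))"
    using x by (simp add: k(1) power_add algebra_simps)
  then have "[u' * x1\<^sup>2 + p ^ k * v' * x2\<^sup>2 = u] (mod p ^ (k + 1))"
    by (rule cong_power_cancel[OF p0])
  then have "[u' * x1\<^sup>2 + p ^ k * v' * x2\<^sup>2 = u] (mod p)"
    by (rule cong_dvd_modulus) simp
  then have "\<not> p dvd u' * x1\<^sup>2 + p ^ k * v' * x2\<^sup>2"
    using u cong_dvd_iff by blast
  moreover have "p dvd p ^ k * v' * x2\<^sup>2"
    using k(2) by simp
  ultimately have "\<not> p dvd u' * x1\<^sup>2"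
    by (simp add: dvd_add_left_iff)
  then have "\<not> p dvd u' * x1"
    by (auto simp: power2_eq_square simp flip: mult.assoc)
  then have cop: "coprime (p ^ k) (u' * x1)"
    using p by (simp add: prime_imp_coprime del: coprime_mult_right_iff)
  have "[p ^ i * (u' * x1 * y1 + p ^ k * v' * x2 * y2) = p ^ i * 0] (mod p ^ (i + (k + 1)))"
    using xy by (simp add: k(1) power_add algebra_simps)
  then have "[u' * x1 * y1 + p ^ k * v' * x2 * y2 = 0] (mod p ^ (k + 1))"
    by (rule cong_power_cancel[OF p0])
  then have "p ^ k dvd u' * x1 * y1 + p ^ k * v' * x2 * y2"
    by (auto simp: cong_0_iff dest: dvd_mult_right)
  then have "p ^ k dvd u' * x1 * y1"
    by (simp add: dvd_add_left_iff mult.assoc)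
  then have "p ^ k dvd y1"
    using cop by (simp add: coprime_dvd_mult_right_iff)
  \<comment> \<open>One factor \<open>p\<close> beyond \<open>p ^ k\<close> in y1^2 is enough to
    reach the exponent j + 1 = i + k + 1.\<close>
  moreover have "p dvd y1"
    using calculation k(2) by (meson dvd_power dvd_trans)
  ultimately have "p ^ k * p dvd y1 * y1"
    by (rule mult_dvd_mono)
  then have "p ^ i * (p ^ k * p) dvd p ^ i * u' * y1\<^sup>2"
    by (simp add: power2_eq_square mult.assoc dvd_mult)
  then have "p ^ (j + 1) dvd p ^ i * u' * y1\<^sup>2"
    by (simp add: k(1) power_add mult_ac)
  moreover have "p ^ (j + 1) dvd p ^ i * u' * y1\<^sup>2 + p ^ j * v' * y2\<^sup>2 - p ^ j * v"
    using y by (simp only: cong_iff_dvd_diff)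
  ultimately have "p ^ (j + 1) dvd p ^ i * u' * y1\<^sup>2 + p ^ j * v' * y2\<^sup>2 - p ^ j * v - p ^ i * u' * y1\<^sup>2"
    by (rule dvd_diff[rotated])
  then have "[p ^ j * (v' * y2\<^sup>2) = p ^ j * v] (mod p ^ (j + 1))"
    by (simp add: cong_iff_dvd_diff mult.assoc)
  then have "[v' * y2\<^sup>2 = v] (mod p ^ 1)"
    by (rule cong_power_cancel[OF p0])
  then have "[v' * y2\<^sup>2 = v] (mod p)" by simp
  then show thesis by (rule that[OF cong_sym])
qed

text \<open>Modulo \<open>p\<close>, the Gram determinants of \<open>u x\<^sup>2 + v y\<^sup>2\<close> and \<open>u' x\<^sup>2 + v' y\<^sup>2\<close> differ by a square.\<close>

lemma quat_equiv_discriminant: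
  fixes p :: int
  assumes p: "prime p" and ij: "0 < i" "i < s"
    and eq: "quat_equiv (p ^ s) (p ^ i * u) (p ^ i * v) (p ^ i * u') (p ^ i * v')"
  obtains x where "[u * v = u' * v' * x\<^sup>2] (mod p)"
proof -
  have p0: "p \<noteq> 0" using p by auto
  have "p ^ (i + 1) dvd p ^ (i + i)"
    using ij by (intro le_imp_power_dvd) simp
  then have "p ^ (i + 1) dvd p ^ (i + i) * (u' * v')"
    by (rule dvd_mult2)
  then have dv: "p ^ (i + 1) dvd p ^ i * u' * (p ^ i * v')"
    by (simp add: power_add mult_ac)
  obtain x1 x2 y1 y2 where
    x: "[p ^ i * u' * x1\<^sup>2 + p ^ i * v' * x2\<^sup>2 = p ^ i * u] (mod p ^ (i + 1))" and
    y: "[p ^ i * u' * y1\<^sup>2 + p ^ i * v' * y2\<^sup>2 = p ^ i * v] (mod p ^ (i + 1))" and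
    xy: "[p ^ i * u' * x1 * y1 + p ^ i * v' * x2 * y2 = 0] (mod p ^ (i + 1))"
    by (rule quat_equiv_drop_third[OF _ dv eq]) (use ij in auto)
  have cancel: "[f + g = w] (mod p)" if "[p ^ i * f + p ^ i * g = p ^ i * w] (mod p ^ (i + 1))" for f g w
    using cong_power_cancel[OF p0, of i "f + g" w 1] that by (simp add: distrib_left)
  have 1: "[u' * x1\<^sup>2 + v' * x2\<^sup>2 = u] (mod p)"
    by (rule cancel) (use x in \<open>simp only: mult.assoc\<close>)
  have 2: "[u' * y1\<^sup>2 + v' * y2\<^sup>2 = v] (mod p)"
    by (rule cancel) (use y in \<open>simp only: mult.assoc\<close>)
  have 3: "[u' * x1 * y1 + v' * x2 * y2 = 0] (mod p)"
    by (rule cancel) (use xy in \<open>simp only: mult.assoc mult_zero_right\<close>)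
  \<comment> \<open>The Gram determinant of the two vectors is that of the form times the square of
    their coordinate determinant; orthogonality makes the Gram matrix diagonal modulo
    \<open>p\<close>.\<close>
  have "u' * v' * (x1 * y2 - x2 * y1)\<^sup>2 = (u' * x1\<^sup>2 + v' * x2\<^sup>2) * (u' * y1\<^sup>2 + v' * y2\<^sup>2) -
      (u' * x1 * y1 + v' * x2 * y2) * (u' * x1 * y1 + v' * x2 * y2)"
    by (simp add: power2_eq_square algebra_simps)
  also have "[\<dots> = u * v - 0 * 0] (mod p)"
    by (rule cong_diff[OF cong_mult[OF 1 2] cong_mult[OF 3 3]])
  finally have "[u' * v' * (x1 * y2 - x2 * y1)\<^sup>2 = u * v] (mod p)" by simp
  then show thesis by (rule that[OF cong_sym])
qed

section \<open>Counting isomorphism classes\<close>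

lemma quat_equiv_refl: "quat_equiv n a b a b"
  by (rule quat_equiv_cong) simp_all

text \<open>Inherited from ring isomorphism, so that no matrix has to be inverted modulo
  \<open>n\<close>.\<close>

lemma quat_equiv_sym:
  assumes "odd n" "quat_equiv n a b c d"
  shows "quat_equiv n c d a b"
  using assms ring_iso_sym[OF ring_quat_ring_mod] by (auto simp: quat_equiv_iff_iso)

lemma quat_equiv_trans:
  assumes "odd n" "quat_equiv n a b c d" "quat_equiv n c d e f"
  shows "quat_equiv n a b e f"
  using assms ring_iso_trans by (auto simp: quat_equiv_iff_iso)

text \<open>
  The index \<open>(i, j, u, v)\<close> stands for the parameters \<open>(p\<^sup>i u, p\<^sup>j v)\<close> modulo \<open>p\<^sup>s\<close>, so that the exponent \<open>s\<close>
  encodes the parameter \<open>0\<close>; \<open>e\<close> is a nonresidue.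
\<close>

definition quat_indices :: "nat \<Rightarrow> int \<Rightarrow> (nat \<times> nat \<times> int \<times> int) set" where
  "quat_indices s e =
    {0} \<times> {0} \<times> {1} \<times> {1} \<union> {0} \<times> {1..s} \<times> {1, e} \<times> {1} \<union>
    (\<lambda>(i, v). (i, i, 1, v)) ` ({1..<s} \<times> {1, e}) \<union>
    (SIGMA i:{1..<s}. {i<..<s} \<times> {1, e} \<times> {1, e}) \<union>
    {1..<s} \<times> {s} \<times> {1, e} \<times> {1} \<union> {s} \<times> {s} \<times> {1} \<times> {1}"

section \<open>The number of canonical parameters modulo a prime power\<close>

text \<open>The sum is (s - 1)(s - 2) / 2; the equation is arranged to avoid division and further
  subtraction of naturals.\<close>

lemma sum_diff_nat_gauss: "2 * (\<Sum>i\<in>{1..<s}. s - Suc i) + 3 * s = s\<^sup>2 + 2" if "0 < s" for s :: nat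
proof -
  have "2 * (\<Sum>i\<in>{1..<Suc m}. Suc m - Suc i) + 3 * Suc m = (Suc m)\<^sup>2 + 2" for m
  proof (induction m)
    case (Suc m)
    have "(\<Sum>i\<in>{1..<Suc (Suc m)}. Suc (Suc m) - Suc i) = (\<Sum>i\<in>{1..<Suc m}. Suc m - Suc i) + m"
    proof -
      have "(\<Sum>i\<in>{1..<Suc (Suc m)}. Suc (Suc m) - Suc i) = (\<Sum>i\<in>{1..<Suc m}. Suc (Suc m) - Suc i)"
        by (subst sum.atLeastLessThan_Suc) simp_all
      also have "\<dots> = (\<Sum>i\<in>{1..<Suc m}. (Suc m - Suc i) + 1)"
        by (rule sum.cong) auto
      also have "\<dots> = (\<Sum>i\<in>{1..<Suc m}. Suc m - Suc i) + (\<Sum>i\<in>{1..<Suc m}. 1)"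
        by (rule sum.distrib)
      finally show ?thesis by (simp del: sum.op_ivl_Suc)
    qed
    then show ?case using Suc by (simp add: power2_eq_square del: sum.op_ivl_Suc)
  qed (simp add: power2_eq_square)
  from this[of "s - 1"] that show ?thesis by simp
qed

lemma card_quat_indices:
  assumes "0 < s" "e \<noteq> 1"
  shows "card (quat_indices s e) = 2 * (s\<^sup>2 + 1)"
proof -
  have e2: "card {1, e} = 2" using assms(2) by simp
  have "inj_on (\<lambda>(i, v). (i, i, 1::int, v)) ({1..<s} \<times> {1, e})"
    by (auto simp: inj_on_def)
  then have img: "card ((\<lambda>(i, v). (i, i, 1::int, v)) ` ({1..<s} \<times> {1, e})) = 2 * (s - 1)"
    using e2 by (simp add: card_image card_cartesian_product)
  have fib: "card ({i<..<s} \<times> {1, e} \<times> {1, e}) = (s - Suc i) * 4" for i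
    by (simp only: card_cartesian_product e2 card_greaterThanLessThan)
  have "card (SIGMA i:{1..<s}. {i<..<s} \<times> {1, e} \<times> {1, e}) =
      (\<Sum>i\<in>{1..<s}. card ({i<..<s} \<times> {1, e} \<times> {1, e}))"
    by (rule card_SigmaI) auto
  also have "\<dots> = (\<Sum>i\<in>{1..<s}. (s - Suc i) * 4)"
    by (simp only: fib)
  finally have sig: "card (SIGMA i:{1..<s}. {i<..<s} \<times> {1, e} \<times> {1, e}) = 4 * (\<Sum>i\<in>{1..<s}. s - Suc i)"
    by (simp add: sum_distrib_left mult.commute)
  define A B C D E F :: "(nat \<times> nat \<times> int \<times> int) set"
    where "A = {0} \<times> {0} \<times> {1} \<times> {1}" and "B = {0} \<times> {1..s} \<times> {1, e} \<times> {1}"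
      and "C = (\<lambda>(i, v). (i, i, 1, v)) ` ({1..<s} \<times> {1, e})"
      and "D = (SIGMA i:{1..<s}. {i<..<s} \<times> {1, e} \<times> {1, e})"
      and "E = {1..<s} \<times> {s} \<times> {1, e} \<times> {1}" and "F = {s} \<times> {s} \<times> {1} \<times> {1}"
  note defs = A_def B_def C_def D_def E_def F_def
  have fin: "finite A" "finite B" "finite C" "finite D" "finite E" "finite F"
    by (simp_all add: defs)
  \<comment> \<open>Here 0 < s matters: for s = 0 the first and the last block coincide.\<close>
  have disj: "A \<inter> B = {}" "(A \<union> B) \<inter> C = {}" "(A \<union> B \<union> C) \<inter> D = {}"
      "(A \<union> B \<union> C \<union> D) \<inter> E = {}" "(A \<union> B \<union> C \<union> D \<union> E) \<inter> F = {}"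
    using assms(1) by (auto simp: defs)
  have "card A = 1" "card B = 2 * s" "card E = 2 * (s - 1)" "card F = 1"
    unfolding defs by (simp_all only: card_cartesian_product e2) simp_all
  moreover have "card (quat_indices s e) = card A + card B + card C + card D + card E + card F"
    unfolding quat_indices_def defs[symmetric]
    by (simp only: card_Un_disjoint fin disj finite_Un simp_thms)
  ultimately have "card (quat_indices s e) = 1 + 2 * s + 2 * (s - 1) + 4 * (\<Sum>i\<in>{1..<s}. s - Suc i) + 2 * (s - 1) + 1"
    by (simp only: img[folded C_def] sig[folded D_def])
  then show ?thesis
    using sum_diff_nat_gauss[OF assms(1)] assms(1) by (simp add: algebra_simps)
qed

section \<open>Existence and uniqueness of canonical parameters\<close>

text \<open>Multiples of \<open>p ^ s\<close> get exponent \<open>s\<close> and unit 1; for all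
  others the exact multiplicity of \<open>p\<close> is below \<open>s\<close>.\<close>

lemma capped_valuation:
  fixes p a :: int
  assumes "prime p"
  obtains i u where "i \<le> s" "\<not> p dvd u" "[a = p ^ i * u] (mod p ^ s)"
proof (cases "p ^ s dvd a")
  case True
  then have "[a = p ^ s * 1] (mod p ^ s)" by (simp add: cong_iff_dvd_diff)
  then show thesis using that[of s 1] assms by auto
next
  case False
  then have "a \<noteq> 0" by auto
  moreover have "\<not> is_unit p" using assms by auto
  ultimately obtain u where u: "a = p ^ multiplicity p a * u" "\<not> p dvd u"
    using multiplicity_decompose'[of a p] by metis
  have "multiplicity p a < s"
    using False multiplicity_dvd' by (metis linorder_not_less)
  then show thesis using that[of "multiplicity p a" u] u by simp
qed

text \<open>A swap arranges i \<le> j; six cases then match the six blocks of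
  \<open>quat_indices\<close>. For i = 0, \<open>norm\<close> removes the second unit; for i = j,
  \<open>binary\<close> gathers both units in the second parameter; \<open>top\<close> discards the
  unit of a vanishing parameter; \<open>scale\<close> leaves only 1 or \<open>e\<close>.\<close>

lemma quat_equiv_index_exists:
  fixes p e a b :: int
  assumes p: "prime p" "odd p" and e: "\<not> QuadRes p e" "\<not> p dvd e"
  shows "\<exists>(i, j, u, v) \<in> quat_indices s e. quat_equiv (p ^ s) a b (p ^ i * u) (p ^ j * v)"
proof -
  define n where "n = p ^ s"
  have n: "odd n" using p by (simp add: n_def)
  note trans = quat_equiv_trans[OF n]
  have cop: "coprime x n" if "\<not> p dvd x" for x
    using prime_imp_coprime[OF p(1) that] by (simp add: n_def coprime_commute)
  have square_class: "\<exists>w x. w \<in> {1, e} \<and> coprime x n \<and> [u = w * x\<^sup>2] (mod n)" if "\<not> p dvd u" for u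
    using unit_square_class_cases[OF p e that, of s] cop unfolding n_def by metis
  \<comment> \<open>The form v x^2 - a v y^2 has unit coefficients and therefore represents a unit
    square.\<close>
  have norm: "quat_equiv n a (m * v) a m" if av: "\<not> p dvd a" "\<not> p dvd v" for a v m
  proof -
    have "\<not> p dvd - a * v" using av p(1) by (simp add: prime_dvd_mult_iff)
    then obtain x y z where z: "\<not> p dvd z" "[v * x\<^sup>2 + - a * v * y\<^sup>2 = z\<^sup>2] (mod p ^ s)"
      using binary_form_represents_unit_square[OF p av(2)] by metis
    then have "quat_equiv n a (m * z\<^sup>2) a (m * v)"
      by (intro quat_equiv_norm[of v x a y] cop) (simp_all add: n_def)
    then have "quat_equiv n a (m * v) a (m * z\<^sup>2)"
      by (rule quat_equiv_sym[OF n])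
    moreover have "quat_equiv n a (m * z\<^sup>2) a m"
      by (rule quat_equiv_scale[of 1 _ z]) (use cop z(1) in auto)
    ultimately show ?thesis by (rule trans)
  qed
  have binary: "quat_equiv n (m * u) (m * v) m (m * (u * v))" if uv: "\<not> p dvd u" "\<not> p dvd v" for m u v
  proof -
    obtain x y z where z: "\<not> p dvd z" "[u * x\<^sup>2 + v * y\<^sup>2 = z\<^sup>2] (mod p ^ s)"
      using binary_form_represents_unit_square[OF p uv] by metis
    then have "quat_equiv n (m * z\<^sup>2) (m * u * v * z\<^sup>2) (m * u) (m * v)"
      by (intro quat_equiv_binary cop) (simp_all add: n_def)
    then have "quat_equiv n (m * u) (m * v) (m * z\<^sup>2) (m * u * v * z\<^sup>2)"
      by (rule quat_equiv_sym[OF n])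
    moreover have "quat_equiv n (m * z\<^sup>2) (m * u * v * z\<^sup>2) m (m * (u * v))"
      by (rule quat_equiv_scale[of z _ z]) (use cop z(1) in \<open>auto simp: mult.assoc\<close>)
    ultimately show ?thesis by (rule trans)
  qed
  have scale: "quat_equiv n (m * u) (m' * v) (m * w) (m' * w')"
    if "coprime x n" "[u = w * x\<^sup>2] (mod n)" "coprime y n" "[v = w' * y\<^sup>2] (mod n)" for m m' u v w w' x y
    using that by (intro quat_equiv_scale[of x _ y]) (auto simp: mult.assoc intro: cong_mult)
  have main: "\<exists>(i, j, u, v) \<in> quat_indices s e. quat_equiv n a b (p ^ i * u) (p ^ j * v)"
    if ij: "i \<le> j" "j \<le> s" and \<alpha>: "\<not> p dvd \<alpha>" "[a = p ^ i * \<alpha>] (mod n)"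
      and \<beta>: "\<not> p dvd \<beta>" "[b = p ^ j * \<beta>] (mod n)" for a b i j \<alpha> \<beta>
  proof -
    have start: "quat_equiv n a b (p ^ i * \<alpha>) (p ^ j * \<beta>)"
      using \<alpha>(2) \<beta>(2) by (rule quat_equiv_cong)
    obtain u x where u: "u \<in> {1, e}" "coprime x n" "[\<alpha> = u * x\<^sup>2] (mod n)"
      using square_class[OF \<alpha>(1)] by blast
    obtain v y where v: "v \<in> {1, e}" "coprime y n" "[\<beta> = v * y\<^sup>2] (mod n)"
      using square_class[OF \<beta>(1)] by blast
    have \<alpha>\<beta>: "\<not> p dvd \<alpha> * \<beta>" using \<alpha>(1) \<beta>(1) p(1) by (simp add: prime_dvd_mult_iff)
    obtain w z where w: "w \<in> {1, e}" "coprime z n" "[\<alpha> * \<beta> = w * z\<^sup>2] (mod n)"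
      using square_class[OF \<alpha>\<beta>] by blast
    have one: "coprime 1 n" "[1 = 1 * 1\<^sup>2] (mod n)" by simp_all
    have top: "[p ^ s * t = p ^ s * 1] (mod n)" for t
      by (simp add: n_def cong_iff_dvd_diff flip: right_diff_distrib)
    consider "i = 0" "j = 0" | "i = 0" "0 < j" | "0 < i" "i = j" "j < s" | "0 < i" "i < j" "j < s"
      | "0 < i" "i < s" "j = s" | "i = s" "j = s"
      using ij by linarith
    then show ?thesis
    proof cases
      case 1
      \<comment> \<open>Two moves: \<open>binary\<close> leads to (1, \<alpha> \<beta>), and
        \<open>norm\<close> with first parameter 1 leads on to (1, 1).\<close>
      have "quat_equiv n (p ^ 0 * \<alpha>) (p ^ 0 * \<beta>) 1 (1 * (\<alpha> * \<beta>))"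
        using binary[OF \<alpha>(1) \<beta>(1), of 1] by simp
      moreover have "quat_equiv n 1 (1 * (\<alpha> * \<beta>)) 1 1"
        using p(1) by (intro norm \<alpha>\<beta>) auto
      ultimately have "quat_equiv n a b (p ^ 0 * 1) (p ^ 0 * 1)"
        using trans start 1 by (metis mult_1 power_0)
      then show ?thesis
        by (intro bexI[of _ "(0, 0, 1, 1)"]) (auto simp: quat_indices_def)
    next
      case 2
      have "quat_equiv n (p ^ 0 * \<alpha>) (p ^ j * \<beta>) (p ^ 0 * \<alpha>) (p ^ j * 1)"
        using norm[OF \<alpha>(1) \<beta>(1), of "p ^ j"] by simp
      moreover have "quat_equiv n (p ^ 0 * \<alpha>) (p ^ j * 1) (p ^ 0 * u) (p ^ j * 1)"
        by (rule scale[OF u(2,3) one])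
      ultimately have "quat_equiv n a b (p ^ 0 * u) (p ^ j * 1)"
        using trans start 2 by metis
      then show ?thesis using 2 ij u(1)
        by (intro bexI[of _ "(0, j, u, 1)"]) (auto simp: quat_indices_def)
    next
      case 3
      have "quat_equiv n (p ^ i * \<alpha>) (p ^ i * \<beta>) (p ^ i * 1) (p ^ i * (\<alpha> * \<beta>))"
        using binary[OF \<alpha>(1) \<beta>(1), of "p ^ i"] by simp
      moreover have "quat_equiv n (p ^ i * 1) (p ^ i * (\<alpha> * \<beta>)) (p ^ i * 1) (p ^ i * w)"
        by (rule scale[OF one w(2,3)])
      ultimately have "quat_equiv n a b (p ^ i * 1) (p ^ i * w)"
        using trans start 3 by metis
      then show ?thesis using 3 ij w(1)
        by (intro bexI[of _ "(i, i, 1, w)"]) (auto simp: quat_indices_def)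
    next
      case 4
      have "quat_equiv n a b (p ^ i * u) (p ^ j * v)"
        by (rule trans[OF start scale[OF u(2,3) v(2,3)]])
      then show ?thesis using 4 ij u(1) v(1)
        by (intro bexI[of _ "(i, j, u, v)"]) (auto simp: quat_indices_def)
    next
      case 5
      have "quat_equiv n (p ^ i * \<alpha>) (p ^ s * \<beta>) (p ^ i * \<alpha>) (p ^ s * 1)"
        by (rule quat_equiv_cong[OF cong_refl top])
      moreover have "quat_equiv n (p ^ i * \<alpha>) (p ^ s * 1) (p ^ i * u) (p ^ s * 1)"
        by (rule scale[OF u(2,3) one])
      ultimately have "quat_equiv n a b (p ^ i * u) (p ^ s * 1)"
        using trans start 5 by metis
      then show ?thesis using 5 ij u(1)
        by (intro bexI[of _ "(i, s, u, 1)"]) (auto simp: quat_indices_def)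
    next
      case 6
      have "quat_equiv n (p ^ s * \<alpha>) (p ^ s * \<beta>) (p ^ s * 1) (p ^ s * 1)"
        by (rule quat_equiv_cong[OF top top])
      then have "quat_equiv n a b (p ^ s * 1) (p ^ s * 1)"
        using trans start 6 by metis
      then show ?thesis
        by (intro bexI[of _ "(s, s, 1, 1)"]) (auto simp: quat_indices_def)
    qed
  qed
  obtain i \<alpha> where \<alpha>: "i \<le> s" "\<not> p dvd \<alpha>" "[a = p ^ i * \<alpha>] (mod n)"
    using capped_valuation[OF p(1), of s a] unfolding n_def by blast
  obtain j \<beta> where \<beta>: "j \<le> s" "\<not> p dvd \<beta>" "[b = p ^ j * \<beta>] (mod n)"
    using capped_valuation[OF p(1), of s b] unfolding n_def by blast
  show ?thesis
  proof (cases "i \<le> j")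
    case True
    then show ?thesis using main[OF True \<beta>(1) \<alpha>(2,3) \<beta>(2,3)] by (simp add: n_def)
  next
    case False
    then have "\<exists>(i, j, u, v) \<in> quat_indices s e. quat_equiv n b a (p ^ i * u) (p ^ j * v)"
      using main[OF _ \<alpha>(1) \<beta>(2,3) \<alpha>(2,3)] by simp
    then show ?thesis
      using trans[OF quat_equiv_swap[of n a b]] unfolding n_def[symmetric] by (auto simp: case_prod_unfold)
  qed
qed

text \<open>The exponents agree by applying the inequalities in both directions. The units then
  agree block by block, through their square classes modulo \<open>p\<close>.\<close>

lemma quat_equiv_index_unique:
  fixes p e :: int
  assumes p: "prime p" "odd p" and e: "\<not> QuadRes p e" "\<not> p dvd e" and s: "0 < s"
    and mem: "(i, j, u, v) \<in> quat_indices s e" "(i', j', u', v') \<in> quat_indices s e"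
    and eq: "quat_equiv (p ^ s) (p ^ i * u) (p ^ j * v) (p ^ i' * u') (p ^ j' * v')"
  shows "(i, j, u, v) = (i', j', u', v')"
proof -
  have n: "odd (p ^ s)" using p by simp
  have eq': "quat_equiv (p ^ s) (p ^ i' * u') (p ^ j' * v') (p ^ i * u) (p ^ j * v)"
    by (rule quat_equiv_sym[OF n eq])
  have p1: "\<not> p dvd 1" using p(1) by auto
  have le: "i \<le> j" "j \<le> s" "i' \<le> j'" "j' \<le> s"
    and uv: "u \<in> {1, e}" "v \<in> {1, e}" "u' \<in> {1, e}" "v' \<in> {1, e}"
    using mem s by (auto simp: quat_indices_def)
  have units: "\<not> p dvd u" "\<not> p dvd v" "\<not> p dvd u'" "\<not> p dvd v'"
    using uv e(2) p1 by auto
  have ii: "i = i'"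
  proof (rule antisym)
    show "i' \<le> i"
      using quat_equiv_first_valuation_le[OF p(1) units(1) le(3) _ eq] le by simp
    show "i \<le> i'"
      using quat_equiv_first_valuation_le[OF p(1) units(3) le(1) _ eq'] le by simp
  qed
  have jj: "j = j'"
  proof (rule antisym)
    show "j' \<le> j"
      using quat_equiv_second_valuation_le[OF p(1) units(1,2) le(1,4)] eq ii by blast
    show "j \<le> j'"
      using quat_equiv_second_valuation_le[OF p(1) units(3,4) le(3,2)] eq' ii by blast
  qed
  note eq = eq[folded ii jj]
  \<comment> \<open>In the blocks with i = j the first unit is 1 by membership.\<close>
  have uu: "u = u'" if "i < j"
    using quat_equiv_first_unit[OF p(1) that _ eq] that le square_class_unique[OF e(1) uv(1,3)]
    by (metis order_less_le_trans)
  consider "i = 0" | "0 < i" "i = j" "j < s" | "0 < i" "i < j" "j < s" | "0 < i" "i < s" "j = s" | "i = s" "j = s"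
    using le by linarith
  then show ?thesis
  proof cases
    case 1
    then show ?thesis using mem s uu by (auto simp: quat_indices_def ii jj)
  next
    case 2
    have "u = 1" "u' = 1" using mem 2 by (auto simp: quat_indices_def ii jj)
    moreover obtain x where "[u * v = u' * v' * x\<^sup>2] (mod p)"
      using quat_equiv_discriminant[OF p(1), of i s u v u' v'] eq 2 by metis
    ultimately have "v = v'"
      using square_class_unique[OF e(1) uv(2,4)] by simp
    then show ?thesis using \<open>u = 1\<close> \<open>u' = 1\<close> ii jj by simp
  next
    case 3
    obtain x where "[v = v' * x\<^sup>2] (mod p)"
      using quat_equiv_second_unit[OF p(1) units(1) 3 eq] .
    then have "v = v'" by (rule square_class_unique[OF e(1) uv(2,4)])
    then show ?thesis using ii jj uu 3 by simp
  next
    case 4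
    have "v = 1" "v' = 1" using mem 4 by (auto simp: quat_indices_def ii jj)
    then show ?thesis using ii jj uu 4 by simp
  next
    case 5
    then show ?thesis using mem s by (auto simp: quat_indices_def ii jj)
  qed
qed

text \<open>Classes are sets of integer pairs rather than of residues, so the same pairs serve all
  moduli.\<close>

definition quat_class :: "int \<Rightarrow> int \<times> int \<Rightarrow> (int \<times> int) set" where
  "quat_class n = (\<lambda>(a, b). {(c, d). quat_equiv n a b c d})"

lemma quat_class_eq_iff:
  assumes n: "odd n"
  shows "quat_class n (a, b) = quat_class n (c, d) \<longleftrightarrow> quat_equiv n a b c d"
proof
  assume "quat_class n (a, b) = quat_class n (c, d)"
  moreover have "(c, d) \<in> quat_class n (c, d)"
    by (simp add: quat_class_def quat_equiv_refl)
  ultimately have "(c, d) \<in> quat_class n (a, b)" by simp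
  then show "quat_equiv n a b c d" by (simp add: quat_class_def)
next
  assume eq: "quat_equiv n a b c d"
  have "quat_equiv n a b e f \<longleftrightarrow> quat_equiv n c d e f" for e f
    using quat_equiv_trans[OF n eq, of e f] quat_equiv_trans[OF n quat_equiv_sym[OF n eq], of e f]
    by blast
  then show "quat_class n (a, b) = quat_class n (c, d)"
    by (auto simp: quat_class_def)
qed

lemma card_quat_classes_prime_power:
  fixes p :: int
  assumes p: "prime p" "odd p" and s: "0 < s"
  shows "card (range (quat_class (p ^ s))) = 2 * (s\<^sup>2 + 1)"
proof -
  have n: "odd (p ^ s)" using p by simp
  obtain e where e: "\<not> QuadRes p e" "\<not> p dvd e"
    using nonresidue_one_plus_square[OF p] by metis
  have "QuadRes p 1" by (auto simp: QuadRes_def intro: exI[of _ 1])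
  then have e1: "e \<noteq> 1" using e(1) by auto
  define rep where "rep = (\<lambda>(i, j, u, v). (p ^ i * u, p ^ j * v))"
  have "quat_class (p ^ s) (a, b) \<in> quat_class (p ^ s) ` rep ` quat_indices s e" for a b
  proof -
    obtain i j u v where "(i, j, u, v) \<in> quat_indices s e"
      "quat_equiv (p ^ s) a b (p ^ i * u) (p ^ j * v)"
      using quat_equiv_index_exists[OF p e, of s a b] by blast
    then have "quat_class (p ^ s) (a, b) = quat_class (p ^ s) (rep (i, j, u, v))"
      by (simp add: rep_def quat_class_eq_iff[OF n])
    then show ?thesis using \<open>(i, j, u, v) \<in> quat_indices s e\<close> by blast
  qed
  then have "range (quat_class (p ^ s)) = quat_class (p ^ s) ` rep ` quat_indices s e"
    by auto
  then have range: "range (quat_class (p ^ s)) = (quat_class (p ^ s) \<circ> rep) ` quat_indices s e"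
    by (simp only: image_comp)
  have "inj_on (quat_class (p ^ s) \<circ> rep) (quat_indices s e)"
  proof (rule inj_onI)
    fix x y assume xy: "x \<in> quat_indices s e" "y \<in> quat_indices s e"
      "(quat_class (p ^ s) \<circ> rep) x = (quat_class (p ^ s) \<circ> rep) y"
    obtain i j u v i' j' u' v' where x: "x = (i, j, u, v)" and y: "y = (i', j', u', v')"
      by (metis prod_cases4)
    have "quat_equiv (p ^ s) (p ^ i * u) (p ^ j * v) (p ^ i' * u') (p ^ j' * v')"
      using xy(3) by (simp add: x y rep_def quat_class_eq_iff[OF n])
    then show "x = y"
      using quat_equiv_index_unique[OF p e s xy(1,2)[unfolded x y]] unfolding x y by blast
  qed
  then show ?thesis
    unfolding range by (simp only: card_image card_quat_indices[OF s e1])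
qed

section \<open>Reduction to prime powers by the Chinese remainder theorem\<close>

lemma dvd_iff_prime_powers_dvd:
  fixes n x :: int
  assumes "n \<noteq> 0"
  shows "n dvd x \<longleftrightarrow> (\<forall>p\<in>prime_factors n. p ^ multiplicity p n dvd x)"
proof (intro iffI ballI)
  show "p ^ multiplicity p n dvd x" if "n dvd x" for p
    using that multiplicity_dvd dvd_trans by blast
next
  assume *: "\<forall>p\<in>prime_factors n. p ^ multiplicity p n dvd x"
  show "n dvd x"
  proof (cases "x = 0")
    case False
    show ?thesis
    proof (rule multiplicity_le_imp_dvd[OF assms])
      fix p :: int assume p: "prime p"
      show "multiplicity p n \<le> multiplicity p x"
      proof (cases "p dvd n")
        case True
        then have "p ^ multiplicity p n dvd x"
          using * p assms by (simp add: prime_factors_dvd)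
        then show ?thesis
          using p False by (intro multiplicity_geI) auto
      qed (simp add: not_dvd_imp_multiplicity_0)
    qed
  qed simp
qed

lemma chinese_remainder_int:
  fixes m u :: "'a \<Rightarrow> int"
  assumes "finite A" "\<And>i j. i \<in> A \<Longrightarrow> j \<in> A \<Longrightarrow> i \<noteq> j \<Longrightarrow> coprime (m i) (m j)"
  shows "\<exists>x. \<forall>i\<in>A. [x = u i] (mod m i)"
  using assms
proof (induction A rule: finite_induct)
  case (insert i A)
  then obtain y where y: "\<forall>j\<in>A. [y = u j] (mod m j)" by blast
  have "coprime (m i) (\<Prod>j\<in>A. m j)"
    using insert by (intro prod_coprime_right) auto
  then obtain x where x: "[x = u i] (mod m i)" "[x = y] (mod (\<Prod>j\<in>A. m j))"
    using binary_chinese_remainder_int by blast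
  have "[x = u j] (mod m j)" if "j \<in> A" for j
  proof -
    have "m j dvd (\<Prod>j\<in>A. m j)" using insert.hyps(1) that by (rule dvd_prodI)
    then show ?thesis using cong_dvd_modulus[OF x(2)] y that cong_trans by blast
  qed
  then show ?case using x(1) by auto
qed simp

lemma chinese_remainder_prime_powers:
  fixes n :: int and u :: "int \<Rightarrow> int"
  shows "\<exists>x. \<forall>p\<in>prime_factors n. [x = u p] (mod p ^ multiplicity p n)"
  by (rule chinese_remainder_int) (auto intro: primes_coprime)

lemma quat_basis_cong:
  assumes "[x1 = x1'] (mod n)" "[x2 = x2'] (mod n)" "[x3 = x3'] (mod n)"
    "[y1 = y1'] (mod n)" "[y2 = y2'] (mod n)" "[y3 = y3'] (mod n)"
    and "quat_basis n a b c d x1 x2 x3 y1 y2 y3"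
  shows "quat_basis n a b c d x1' x2' x3' y1' y2' y3'"
proof -
  have "[c * x1'\<^sup>2 + d * x2'\<^sup>2 - c * d * x3'\<^sup>2 = c * x1\<^sup>2 + d * x2\<^sup>2 - c * d * x3\<^sup>2] (mod n)"
    by (intro cong_add cong_diff cong_mult cong_pow cong_refl cong_sym[OF assms(1)] cong_sym[OF assms(2)] cong_sym[OF assms(3)])
  moreover have "[c * y1'\<^sup>2 + d * y2'\<^sup>2 - c * d * y3'\<^sup>2 = c * y1\<^sup>2 + d * y2\<^sup>2 - c * d * y3\<^sup>2] (mod n)"
    by (intro cong_add cong_diff cong_mult cong_pow cong_refl cong_sym[OF assms(4)] cong_sym[OF assms(5)] cong_sym[OF assms(6)])
  moreover have "[c * x1' * y1' + d * x2' * y2' - c * d * x3' * y3' = c * x1 * y1 + d * x2 * y2 - c * d * x3 * y3] (mod n)"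
    by (intro cong_add cong_diff cong_mult cong_refl assms(1-6)[THEN cong_sym])
  moreover have "[(x1 * y2 - x2 * y1)\<^sup>2 - c * (x3 * y1 - x1 * y3)\<^sup>2 - d * (x2 * y3 - x3 * y2)\<^sup>2 =
      (x1' * y2' - x2' * y1')\<^sup>2 - c * (x3' * y1' - x1' * y3')\<^sup>2 - d * (x2' * y3' - x3' * y2')\<^sup>2] (mod n)"
    by (intro cong_diff cong_mult cong_pow cong_refl assms(1-6))
  ultimately show ?thesis
    using assms(7) unfolding quat_basis_def by (meson cong_imp_coprime cong_trans)
qed

lemma coprime_if_coprime_prime_powers:
  fixes n D :: int
  assumes "n \<noteq> 0" "\<And>p. p \<in> prime_factors n \<Longrightarrow> coprime D (p ^ multiplicity p n)"
  shows "coprime D n"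
proof (rule ccontr)
  assume "\<not> coprime D n"
  then have "\<not> is_unit (gcd D n)" by (simp add: coprime_iff_gcd_eq_1)
  moreover have "gcd D n \<noteq> 0" using assms(1) by simp
  ultimately obtain p where p: "prime p" "p dvd gcd D n"
    using prime_divisor_exists by blast
  then have pn: "p \<in> prime_factors n" and pD: "p dvd D"
    using assms(1) by (auto simp: prime_factors_dvd)
  have "0 < multiplicity p n"
    using pn by (simp add: prime_factors_multiplicity)
  then have "p dvd p ^ multiplicity p n" by simp
  then have "is_unit p"
    using assms(2)[OF pn] pD coprime_common_divisor by blast
  then show False using p(1) by auto
qed

text \<open>Solutions modulo the prime powers are glued coordinate by coordinate; the congruences
  and the coprimality of the determinant can be tested at each prime power.\<close>

lemma quat_equiv_iff_prime_powers:
  assumes n: "n \<noteq> 0"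
  shows "quat_equiv n a b c d \<longleftrightarrow> (\<forall>p\<in>prime_factors n. quat_equiv (p ^ multiplicity p n) a b c d)"
proof (intro iffI ballI)
  fix p assume "quat_equiv n a b c d"
  moreover have "p ^ multiplicity p n dvd n" by (rule multiplicity_dvd)
  ultimately show "quat_equiv (p ^ multiplicity p n) a b c d"
    unfolding quat_equiv_def quat_basis_def
    by (meson cong_dvd_modulus coprime_divisors dvd_refl)
next
  let ?P = "prime_factors n" and ?q = "\<lambda>p. p ^ multiplicity p n"
  assume *: "\<forall>p\<in>?P. quat_equiv (?q p) a b c d"
  \<comment> \<open>The six unknowns are packed into one function, so that a single choice and a
    single use of the remainder theorem cover them all.\<close>
  have "\<exists>t :: int \<Rightarrow> int. quat_basis (?q p) a b c d (t 1) (t 2) (t 3) (t 4) (t 5) (t 6)" if p: "p \<in> ?P" for p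
  proof -
    obtain x1 x2 x3 y1 y2 y3 where "quat_basis (?q p) a b c d x1 x2 x3 y1 y2 y3"
      using * p unfolding quat_equiv_def by blast
    then show ?thesis
      by (intro exI[of _ "(\<lambda>_. 0)(1 := x1, 2 := x2, 3 := x3, 4 := y1, 5 := y2, 6 := y3 :: int)"]) simp
  qed
  then obtain T :: "int \<Rightarrow> int \<Rightarrow> int" where T: "\<forall>p\<in>?P. quat_basis (?q p) a b c d (T p 1) (T p 2) (T p 3) (T p 4) (T p 5) (T p 6)"
    by metis
  have "\<forall>k. \<exists>y. \<forall>p\<in>?P. [y = T p k] (mod ?q p)"
    by (intro allI chinese_remainder_prime_powers)
  then obtain x where x: "\<And>k. \<forall>p\<in>?P. [x k = T p k] (mod ?q p)"
    by metis
  have "quat_basis (?q p) a b c d (x 1) (x 2) (x 3) (x 4) (x 5) (x 6)" if p: "p \<in> ?P" for p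
    by (rule quat_basis_cong[rotated 6]) (use T x p in \<open>auto intro: cong_sym\<close>)
  then have "quat_basis n a b c d (x 1) (x 2) (x 3) (x 4) (x 5) (x 6)"
    unfolding quat_basis_def cong_iff_dvd_diff
    by (auto intro!: coprime_if_coprime_prime_powers[OF n] simp: dvd_iff_prime_powers_dvd[OF n])
  then show "quat_equiv n a b c d" unfolding quat_equiv_def by blast
qed

section \<open>From classes of parameters to classes of rings\<close>

text \<open>Pulled back along \<open>F\<close>, the relation is equality of \<open>g\<close>, so
  each class is the \<open>F\<close>-image of a fibre of \<open>g\<close> and is determined by a
  value of \<open>g\<close>.\<close>

lemma card_quotient_eq_card_image:
  assumes "r \<subseteq> (F ` B) \<times> (F ` B)" and "\<And>x y. x \<in> B \<Longrightarrow> y \<in> B \<Longrightarrow> (F x, F y) \<in> r \<longleftrightarrow> g x = g y"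
  shows "card ((F ` B) // r) = card (g ` B)"
proof -
  define G where "G = (\<lambda>c. F ` {y \<in> B. g y = c})"
  have G: "r `` {F x} = G (g x)" if "x \<in> B" for x
    using assms that unfolding G_def by fastforce
  have "(F ` B) // r = (\<lambda>x. r `` {F x}) ` B"
    by (auto simp: quotient_def)
  also have "\<dots> = (\<lambda>x. G (g x)) ` B"
    by (rule image_cong) (simp_all add: G)
  also have "\<dots> = G ` g ` B"
    by (simp add: image_image)
  finally have *: "(F ` B) // r = G ` g ` B" .
  have "inj_on G (g ` B)"
  proof (rule inj_onI, clarify)
    fix x y assume xy: "x \<in> B" "y \<in> B" "G (g x) = G (g y)"
    have "F x \<in> G (g y)" using xy unfolding G_def by blast
    then obtain z where z: "z \<in> B" "g z = g y" "F x = F z" by (auto simp: G_def)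
    \<comment> \<open>The pair of \<open>F z\<close> with itself lies in \<open>r\<close>; as F x =
      F z, this yields g x = g z.\<close>
    then show "g x = g y" using assms(2)[OF xy(1) z(1)] assms(2)[OF z(1,1)] by simp
  qed
  then show ?thesis unfolding * by (rule card_image)
qed

theorem corollary5:
  fixes n :: int
  assumes "odd n"
  shows "card (quaternion_rings (ZFact n) // ring_iso_rel (quaternion_rings (ZFact n))) =
    2 ^ card (prime_factors n) * (\<Prod>p\<in>prime_factors n. (multiplicity p n)\<^sup>2 + 1)"
proof -
  let ?P = "prime_factors n" and ?q = "\<lambda>p. p ^ multiplicity p n"
  have n0: "n \<noteq> 0" using assms by auto
  have pP: "prime p" "odd p" "0 < multiplicity p n" "odd (?q p)" if "p \<in> ?P" for p
  proof -
    show "prime p" using that by auto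
    show "odd p" using that assms by (metis in_prime_factors_imp_dvd dvd_trans)
    then show "odd (?q p)" by simp
    show "0 < multiplicity p n" using that by (simp add: prime_factors_multiplicity)
  qed
  define F where "F = (\<lambda>(a, b). quat_ring_mod n a b)"
  \<comment> \<open>The complete invariant: the family of classes modulo the prime powers,
    restricted so as to lie in an extensional product.\<close>
  define g where "g = (\<lambda>x. restrict (\<lambda>p. quat_class (?q p) x) ?P)"
  have Q: "quaternion_rings (ZFact n) = range F"
    by (auto simp: quaternion_rings_def F_def carrier_ZFact)
  have "card (range F // ring_iso_rel (range F)) = card (range g)"
  proof (rule card_quotient_eq_card_image)
    show "ring_iso_rel (range F) \<subseteq> range F \<times> range F"
      by (auto simp: ring_iso_rel_def)
    fix x y :: "int \<times> int"
    obtain a b c d where xy: "x = (a, b)" "y = (c, d)" by fastforce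
    have "(F x, F y) \<in> ring_iso_rel (range F) \<longleftrightarrow> quat_equiv n a b c d"
      by (simp add: xy ring_iso_rel_def quat_equiv_iff_iso[OF assms]) (simp add: F_def)
    also have "\<dots> \<longleftrightarrow> (\<forall>p\<in>?P. quat_class (?q p) x = quat_class (?q p) y)"
      by (simp add: quat_equiv_iff_prime_powers[OF n0] xy quat_class_eq_iff pP)
    also have "\<dots> \<longleftrightarrow> g x = g y"
      by (auto simp: g_def restrict_def fun_eq_iff)
    finally show "(F x, F y) \<in> ring_iso_rel (range F) \<longleftrightarrow> g x = g y" .
  qed
  \<comment> \<open>Every family of local classes occurs, because both parameters can be glued from
    local ones.\<close>
  also have "range g = (\<Pi>\<^sub>E p\<in>?P. range (quat_class (?q p)))"
  proof
    show "range g \<subseteq> (\<Pi>\<^sub>E p\<in>?P. range (quat_class (?q p)))" by (auto simp: g_def)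
    show "(\<Pi>\<^sub>E p\<in>?P. range (quat_class (?q p))) \<subseteq> range g"
    proof
      fix f assume f: "f \<in> (\<Pi>\<^sub>E p\<in>?P. range (quat_class (?q p)))"
      then have "\<forall>p\<in>?P. \<exists>a b. f p = quat_class (?q p) (a, b)" by (fastforce simp: PiE_iff)
      then obtain A B where AB: "\<forall>p\<in>?P. f p = quat_class (?q p) (A p, B p)" by metis
      obtain a where a: "\<forall>p\<in>?P. [a = A p] (mod ?q p)"
        using chinese_remainder_prime_powers by blast
      obtain b where b: "\<forall>p\<in>?P. [b = B p] (mod ?q p)"
        using chinese_remainder_prime_powers by blast
      have "quat_class (?q p) (a, b) = f p" if "p \<in> ?P" for p
        using AB a b that quat_class_eq_iff[OF pP(4)[OF that]] quat_equiv_cong by simp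
      then have "g (a, b) = f"
        using f by (intro ext) (auto simp: g_def restrict_def PiE_iff extensional_def)
      then show "f \<in> range g" by blast
    qed
  qed
  also have "card (\<Pi>\<^sub>E p\<in>?P. range (quat_class (?q p))) = (\<Prod>p\<in>?P. card (range (quat_class (?q p))))"
    by (rule card_PiE) simp
  also have "\<dots> = (\<Prod>p\<in>?P. 2 * ((multiplicity p n)\<^sup>2 + 1))"
    using card_quat_classes_prime_power[OF pP(1-3)] by (intro prod.cong) simp_all
  also have "\<dots> = 2 ^ card ?P * (\<Prod>p\<in>?P. (multiplicity p n)\<^sup>2 + 1)"
    by (simp only: prod.distrib prod_constant)
  finally show ?thesis unfolding Q .
qed

end
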